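(* Let $d\ge3$, let $k\ge3$ be odd, let $\Omega\subset\mathbb R^d$ be a bounded Lipschitz polytope and $\mathcal T$ a conforming simplicial mesh of $\Omega$. Let $\operatorname{mark}_{\mathcal T}:\mathcal S\to\mathcal T\cup\mathcal F$ satisfy $\operatorname{mark}_{\mathcal T}(K)=K$ for all $K\in\mathcal T$, and $\operatorname{mark}_{\mathcal T}(\tau)\in\mathcal F$ with $\tau\subseteq\operatorname{mark}_{\mathcal T}(\tau)$ for all $\tau\in\mathcal S\setminus\mathcal T$. Consider functionals of the form $$J_{\tau,\boldsymbol\alpha}u=(g_{\tau,\boldsymbol\alpha},u)_{L^2(\operatorname{mark}_{\mathcal T}(\tau))},\qquad g_{\tau,\boldsymbol\alpha}\in\begin{cases}L^2(\operatorname{mark}_{\mathcal T}(\tau))&\text{if }\operatorname{mark}_{\mathcal T}(\tau)\in\mathcal T,\\ \mathbb P_{k-1}(\operatorname{mark}_{\mathcal T}(\tau))&\text{if }\operatorname{mark}_{\mathcal T}(\tau)\in\mathcal F,\end{cases}$$ for $(\tau,\boldsymbol\alpha)\in\mathcal I_k$, and $$J_F^{\mathrm{CR}}u=(g_F,u)_{L^2(F)},\qquad g_F\in\mathbb P_{k-1}(F),$$ for $F\in\mathcal F$. Then there exists no choice of functionals of this form such that 1. $\{J_{\tau,\boldsymbol\alpha}:(\tau,\boldsymbol\alpha)\in\mathcal I_k\}\cup\{J_F^{\mathrm{CR}}:F\in\mathcal F\}$ is bidual to the basis $\{B_{\tau,\boldsymbol\alpha}:(\tau,\boldsymbol\alpha)\in\mathcal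 I_k\}\cup\{B_k^{\mathrm{CR},F}:F\in\mathcal F\}$ of $\operatorname{CR}_k(\mathcal T)$; and, if there exists $K\in\mathcal T$ with $K\cap\partial\Omega=\emptyset$, there exists no choice of functionals of this form such that 2. $\{J_{\tau,\boldsymbol\alpha}:(\tau,\boldsymbol\alpha)\in\mathcal I_{k,\Omega}\}\cup\{J_F^{\mathrm{CR}}:F\in\mathcal F_\Omega\}$ is bidual to the basis $\{B_{\tau,\boldsymbol\alpha}:(\tau,\boldsymbol\alpha)\in\mathcal I_{k,\Omega}\}\cup\{B_k^{\mathrm{CR},F}:F\in\mathcal F_\Omega\}$ of $\operatorname{CR}_{k,0}(\mathcal T)$. Here "bidual" means that each functional takes the value $1$ at the basis function with the same index (the index being $(\tau,\boldsymbol\alpha)$ or $F$) and $0$ at all other basis functions.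
   Context: A conforming simplicial mesh $\mathcal{T}$ of $\Omega$ is a finite set of closed nondegenerate $d$-simplices with union $\overline\Omega$ such that any two intersect in the empty set or a common face. $\mathcal{V}$ is the set of mesh vertices, $\mathcal{F}$ the set of $(d-1)$-dimensional closed facets, $\mathcal F_\Omega=\{F\in\mathcal F:F\not\subset\partial\Omega\}$; $\mathcal V(\tau)$ is the vertex set of a simplex $\tau$, $\mathcal{T}_F=\{K\in\mathcal{T}:F\subset K\}$. $\lambda_{K,\mathbf z}$ is the barycentric coordinate of $K$ for the vertex $\mathbf z$; $\lambda_{K,F}$ is that of the vertex of $K$ opposite to the facet $F$. $\mathbb P_{m}(F)$ is the space of polynomials of total degree $\le m$ in the local variables of $F$. $P_n^{(\alpha,\beta)}$ is the Jacobi polynomial of degree $n$, orthogonal on $[-1,1]$ with respect to $(1-x)^\alpha(1+x)^\beta$ to all polynomials of degree $<n$, normalized by $P_n^{(\alpha,\beta)}(1)=(\alpha+1)_n/n!$ with $(a)_n=a(a+1)\cdots(a+n-1)$. $B_k^{\mathrm{CR},K}=\frac1d\bigl(-1+\sum_{\mathbf z\in\mathcal V(K)}P_k^{(0,d-2)}(1-2\lambda_{K,\mathbf z})\bigr)$ on $K$ and $0$ elsewhere; $B_k^{\mathrm{CR},F}=P_k^{(0,d-2)}(1-2\lambda_{K,F})-B_k^{\mathrm{CR},K}$ on each $K\in\mathcal{T}_F$ and $0$ elsewhere. $S_k(\mathcal T)$ is the space of continuous functions on $\overline\Omega$ that are polynomials of degree $\le k$ on each $K\in\mathcal T$; $S_{k,0}(\mathcal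 T)=S_k(\mathcal T)\cap H^1_0(\Omega)$. For odd $k$, $\operatorname{CR}_k(\mathcal T)=S_k(\mathcal T)+\operatorname{span}\{B_k^{\mathrm{CR},F}:F\in\mathcal F\}$ and $\operatorname{CR}_{k,0}(\mathcal T)=S_{k,0}(\mathcal T)+\operatorname{span}\{B_k^{\mathrm{CR},F}:F\in\mathcal F_\Omega\}$. The jumps of functions in $\operatorname{CR}_k(\mathcal T)$ across an interior facet $F$ are $L^2(F)$-orthogonal to $\mathbb P_{k-1}(F)$, so facet functionals $(g,\cdot)_{L^2(F)}$ with $g\in\mathbb P_{k-1}(F)$ are well defined on $\operatorname{CR}_k(\mathcal T)$ (the trace may be taken from either adjacent simplex). Faces and conforming functions: $\mathcal S_\ell$ is the set of $\ell$-dimensional faces of simplices of $\mathcal T$, $0\le\ell\le d$ ($\mathcal S_d=\mathcal T$); $\mathcal S=\bigcup_\ell\mathcal S_\ell$. $\varphi^1_{\mathbf z}$ is the continuous piecewise affine hat function of $\mathbf z\in\mathcal V$; $W_\tau=\prod_{\mathbf z\in\mathcal V(\tau)}\varphi^1_{\mathbf z}$. For $\boldsymbol\alpha\in\mathbb N_0^\ell$, $\ell\ge1$, $$P^{\mathrm{bary}}_{\boldsymbol\alpha}(y_0,\dots,y_\ell)=\prod_{j=1}^{\ell}\Bigl(y_0+\sum_{m=j}^\ell y_m\Bigr)^{\alpha_j}P_{\alpha_j}^{(s_j,1)}\Bigl(\tfrac{2y_j}{y_0+\sum_{m=j}^\ell y_m}-1\Bigr),\quad s_j=2\sum_{m=j+1}^\ell\alpha_m+2(\ell-j)+1$$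 (a polynomial), and for $\tau\in\mathcal S_\ell$ with a fixed vertex numbering $\mathbf A_0(\tau),\dots,\mathbf A_\ell(\tau)$, $B_{\tau,\boldsymbol\alpha}=W_\tau P^{\mathrm{bary}}_{\boldsymbol\alpha}(\varphi^1_{\mathbf A_0(\tau)},\dots,\varphi^1_{\mathbf A_\ell(\tau)})$. For odd $k$, $\mathcal I_k$ is the set of all $(\tau,\boldsymbol\alpha)$ with $\tau\in\mathcal S_\ell$, $1\le\ell\le\min\{k-1,d\}$, $\boldsymbol\alpha\in\mathbb N_0^\ell$, $|\boldsymbol\alpha|\le k-(\ell+1)$; $\mathcal I_{k,\Omega}$ is the subset with $\tau\not\subset\partial\Omega$. *)

theory Defs
  imports "HOL-Analysis.Analysis" "HOL-Computational_Algebra.Polynomial"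
begin

section \<open>Domains and meshes\<close>

text \<open>The unit vector e plays the role of the last coordinate axis after a rotation; only the
  values of the Lipschitz function on the hyperplane orthogonal to e matter.\<close>

definition lipschitz_boundary :: "'a::euclidean_space set \<Rightarrow> bool" where
  "lipschitz_boundary \<Omega> \<longleftrightarrow>
     (\<forall>x\<in>frontier \<Omega>. \<exists>r>0. \<exists>e L \<gamma>. norm e = 1 \<and> L-lipschitz_on UNIV (\<gamma> :: 'a \<Rightarrow> real) \<and>
        \<Omega> \<inter> ball x r = {y \<in> ball x r. \<gamma> (y - (y \<bullet> e) *\<^sub>R e) < y \<bullet> e})"

text \<open>The polytope need not be convex; connectedness is not required.\<close>

definition lipschitz_polytope :: "'a::euclidean_space set \<Rightarrow> bool" where
  "lipschitz_polytope \<Omega> \<longleftrightarrow> open \<Omega> \<and> \<Omega> \<noteq> {} \<and> bounded \<Omega> \<and> lipschitz_boundary \<Omega> \<and>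
     (\<exists>\<P>. finite \<P> \<and> (\<forall>P\<in>\<P>. polytope P) \<and> closure \<Omega> = \<Union>\<P>)"

text \<open>The empty set counts as a face in the sense of \<open>face_of\<close>.\<close>

definition conforming_mesh :: "'a::euclidean_space set \<Rightarrow> 'a set set \<Rightarrow> bool" where
  "conforming_mesh \<Omega> \<T> \<longleftrightarrow> finite \<T> \<and> (\<forall>K\<in>\<T>. int DIM('a) simplex K) \<and> \<Union>\<T> = closure \<Omega> \<and>
     (\<forall>K\<in>\<T>. \<forall>K'\<in>\<T>. (K \<inter> K') face_of K \<and> (K \<inter> K') face_of K')"

definition verts :: "'a::euclidean_space set \<Rightarrow> 'a set" where
  "verts \<tau> = {z. z extreme_point_of \<tau>}"

definition mesh_faces :: "'a::euclidean_space set set \<Rightarrow> nat \<Rightarrow> 'a set set" where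
  "mesh_faces \<T> l = {\<tau>. (\<exists>K\<in>\<T>. \<tau> face_of K) \<and> aff_dim \<tau> = int l}"

definition all_faces :: "'a::euclidean_space set set \<Rightarrow> 'a set set" where
  "all_faces \<T> = (\<Union>l\<le>DIM('a). mesh_faces \<T> l)"

definition mesh_vertices :: "'a::euclidean_space set set \<Rightarrow> 'a set" where
  "mesh_vertices \<T> = (\<Union>K\<in>\<T>. verts K)"

definition facets :: "'a::euclidean_space set set \<Rightarrow> 'a set set" where
  "facets \<T> = mesh_faces \<T> (DIM('a) - 1)"

definition interior_facets :: "'a::euclidean_space set \<Rightarrow> 'a set set \<Rightarrow> 'a set set" where
  "interior_facets \<Omega> \<T> = {F \<in> facets \<T>. \<not> F \<subseteq> frontier \<Omega>}"

text \<open>Barycentric coordinates of x with respect to the vertices of K, extended by 0 to all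
  other points of the space so that they are determined uniquely.\<close>

definition bary_coords :: "'a::euclidean_space set \<Rightarrow> 'a \<Rightarrow> 'a \<Rightarrow> real" where
  "bary_coords K x = (THE c. (\<forall>v. v \<notin> verts K \<longrightarrow> c v = 0) \<and> (\<Sum>v\<in>verts K. c v) = 1 \<and>
     (\<Sum>v\<in>verts K. c v *\<^sub>R v) = x)"

definition bary :: "'a::euclidean_space set \<Rightarrow> 'a \<Rightarrow> 'a \<Rightarrow> real" where
  "bary K z x = bary_coords K x z"

definition opposite_vertex :: "'a::euclidean_space set \<Rightarrow> 'a set \<Rightarrow> 'a" where
  "opposite_vertex K F = (THE z. z \<in> verts K \<and> z \<notin> F)"


section \<open>Polynomials\<close>

text \<open>Polynomials of total degree at most m in the variables \<open>x \<bullet> b\<close>, for b in B.\<close>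

definition poly_space :: "'a::euclidean_space set \<Rightarrow> nat \<Rightarrow> ('a \<Rightarrow> real) set" where
  "poly_space B m = {p. \<exists>c. p = (\<lambda>x. \<Sum>\<beta> | \<beta> \<in> B \<rightarrow>\<^sub>E UNIV \<and> (\<Sum>b\<in>B. \<beta> b) \<le> m.
     c \<beta> * (\<Prod>b\<in>B. (x \<bullet> b) ^ \<beta> b))}"

text \<open>An orthonormal basis of the directions of F, giving local variables on F.\<close>

definition tangent_basis :: "'a::euclidean_space set \<Rightarrow> 'a set" where
  "tangent_basis F = (SOME B. pairwise orthogonal B \<and> (\<forall>b\<in>B. norm b = 1) \<and>
     span B = span {x - y |x y. x \<in> F \<and> y \<in> F})"

definition poly_on_face :: "nat \<Rightarrow> 'a::euclidean_space set \<Rightarrow> ('a \<Rightarrow> real) set" where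
  "poly_on_face m F = poly_space (tangent_basis F) m"

text \<open>Only natural parameters a, b occur below.\<close>

definition jacobi :: "nat \<Rightarrow> nat \<Rightarrow> nat \<Rightarrow> real poly" where
  "jacobi a b n = (THE p. degree p = n \<and>
     (\<forall>q. degree q < n \<longrightarrow>
        integral {-1..1} (\<lambda>x. poly p x * poly q x * ((1 - x) ^ a * (1 + x) ^ b)) = 0) \<and>
     poly p 1 = pochhammer (real a + 1) n / fact n)"

text \<open>The polynomial \<open>s ^ n * poly p (t / s)\<close> in s and t, written without division.\<close>

definition homog :: "nat \<Rightarrow> real poly \<Rightarrow> real \<Rightarrow> real \<Rightarrow> real" where
  "homog n p t s = (\<Sum>i\<le>n. coeff p i * t ^ i * s ^ (n - i))"

lemma homog_eq:
  assumes "degree p \<le> n" "s \<noteq> 0"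
  shows "homog n p t s = s ^ n * poly p (t / s)"
proof -
  have "poly p (t / s) = (\<Sum>i\<le>n. coeff p i * (t / s) ^ i)"
    unfolding poly_altdef using assms(1)
    by (intro sum.mono_neutral_left) (auto simp: coeff_eq_0)
  then show ?thesis
    using assms(2) unfolding homog_def
    by (auto simp: sum_distrib_left power_diff power_divide intro!: sum.cong)
qed

text \<open>Multiindices \<open>\<alpha>\<close> are functions on \<open>{1..l}\<close>. The j-th factor is
  \<open>S ^ \<alpha> j * P (2 * y j / S - 1)\<close> with \<open>S = y 0 + (\<Sum>m=j..l. y m)\<close>.\<close>

definition bary_jacobi :: "nat \<Rightarrow> (nat \<Rightarrow> nat) \<Rightarrow> (nat \<Rightarrow> real) \<Rightarrow> real" where
  "bary_jacobi l \<alpha> y = (\<Prod>j=1..l.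
     let S = y 0 + (\<Sum>m=j..l. y m);
         s = 2 * (\<Sum>m=j+1..l. \<alpha> m) + 2 * (l - j) + 1
     in homog (\<alpha> j) (jacobi s 1 (\<alpha> j)) (2 * y j - S) S)"


section \<open>Conforming and Crouzeix--Raviart functions\<close>

text \<open>Piecewise defined functions are families \<open>u\<close>, where \<open>u K\<close> is the function on the closed
  simplex K; the restriction of \<open>u K\<close> to a facet of K is the trace from K. A continuous function
  \<open>v\<close> is the family \<open>\<lambda>K. v\<close>.\<close>

type_synonym 'a broken = "'a set \<Rightarrow> 'a \<Rightarrow> real"

definition S_space :: "nat \<Rightarrow> 'a::euclidean_space set set \<Rightarrow> ('a \<Rightarrow> real) set" where
  "S_space k \<T> = {u. continuous_on (\<Union>\<T>) u \<and>
     (\<forall>K\<in>\<T>. \<exists>p\<in>poly_space Basis k. \<forall>x\<in>K. u x = p x)}"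

definition hat :: "'a::euclidean_space set set \<Rightarrow> 'a \<Rightarrow> 'a \<Rightarrow> real" where
  "hat \<T> z = (SOME \<phi>. \<phi> \<in> S_space 1 \<T> \<and>
     (\<forall>y\<in>mesh_vertices \<T>. \<phi> y = (if y = z then 1 else 0)))"

definition W_face :: "'a::euclidean_space set set \<Rightarrow> 'a set \<Rightarrow> 'a \<Rightarrow> real" where
  "W_face \<T> \<tau> x = (\<Prod>z\<in>verts \<tau>. hat \<T> z x)"

text \<open>\<open>A \<tau> 0, \<dots>, A \<tau> l\<close> are the vertices of an l-dimensional face \<open>\<tau>\<close>.\<close>

definition vertex_numbering ::
  "'a::euclidean_space set set \<Rightarrow> ('a set \<Rightarrow> nat \<Rightarrow> 'a) \<Rightarrow> bool" where
  "vertex_numbering \<T> A \<longleftrightarrow>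
     (\<forall>l\<le>DIM('a). \<forall>\<tau>\<in>mesh_faces \<T> l. bij_betw (A \<tau>) {0..l} (verts \<tau>))"

definition B_conf :: "'a::euclidean_space set set \<Rightarrow> ('a set \<Rightarrow> nat \<Rightarrow> 'a) \<Rightarrow>
    'a set \<Rightarrow> (nat \<Rightarrow> nat) \<Rightarrow> 'a broken" where
  "B_conf \<T> A \<tau> \<alpha> = (\<lambda>K x. W_face \<T> \<tau> x *
     bary_jacobi (nat (aff_dim \<tau>)) \<alpha> (\<lambda>i. hat \<T> (A \<tau> i) x))"

definition index_set ::
  "nat \<Rightarrow> 'a::euclidean_space set set \<Rightarrow> ('a set \<times> (nat \<Rightarrow> nat)) set" where
  "index_set k \<T> = {(\<tau>, \<alpha>). \<exists>l. 1 \<le> l \<and> l \<le> min (k - 1) DIM('a) \<and> \<tau> \<in> mesh_faces \<T> l \<and>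
     \<alpha> \<in> {1..l} \<rightarrow>\<^sub>E UNIV \<and> (\<Sum>j=1..l. \<alpha> j) \<le> k - (l + 1)}"

definition interior_index_set ::
  "nat \<Rightarrow> 'a::euclidean_space set \<Rightarrow> 'a set set \<Rightarrow> ('a set \<times> (nat \<Rightarrow> nat)) set" where
  "interior_index_set k \<Omega> \<T> = {(\<tau>, \<alpha>) \<in> index_set k \<T>. \<not> \<tau> \<subseteq> frontier \<Omega>}"

definition B_CR_elem :: "nat \<Rightarrow> 'a::euclidean_space set \<Rightarrow> 'a broken" where
  "B_CR_elem k K = (\<lambda>K' x. if K' = K
     then (1 / real DIM('a)) *
       (- 1 + (\<Sum>z\<in>verts K. poly (jacobi 0 (DIM('a) - 2) k) (1 - 2 * bary K z x)))
     else 0)"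

definition B_CR_facet :: "nat \<Rightarrow> 'a::euclidean_space set \<Rightarrow> 'a broken" where
  "B_CR_facet k F = (\<lambda>K x. if F \<subseteq> K
     then poly (jacobi 0 (DIM('a) - 2) k) (1 - 2 * bary K (opposite_vertex K F) x)
       - B_CR_elem k K K x
     else 0)"

definition CR_space :: "nat \<Rightarrow> 'a::euclidean_space set set \<Rightarrow> 'a broken set" where
  "CR_space k \<T> = {w. \<exists>u\<in>S_space k \<T>. \<exists>c. \<forall>K\<in>\<T>. \<forall>x\<in>K.
     w K x = u x + (\<Sum>F\<in>facets \<T>. c F * B_CR_facet k F K x)}"


section \<open>Functionals\<close>

text \<open>The Lebesgue measure of appropriate dimension on the affine hull of F, in orthonormal
  coordinates (the library constructs \<open>lborel\<close> in the same way from the standard basis).\<close>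

definition flat_measure :: "'a::euclidean_space set \<Rightarrow> 'a measure" where
  "flat_measure F = distr (\<Pi>\<^sub>M b\<in>tangent_basis F. lborel) borel
     (\<lambda>t. (SOME a. a \<in> F) + (\<Sum>b\<in>tangent_basis F. t b *\<^sub>R b))"

definition L2_elem :: "'a::euclidean_space set \<Rightarrow> ('a \<Rightarrow> real) set" where
  "L2_elem K = {g. g \<in> borel_measurable (lebesgue_on K) \<and>
     integrable (lebesgue_on K) (\<lambda>x. (g x)\<^sup>2)}"

definition elem_functional ::
  "nat \<Rightarrow> 'a::euclidean_space set set \<Rightarrow> 'a set \<Rightarrow> ('a broken \<Rightarrow> real) \<Rightarrow> bool" where
  "elem_functional k \<T> K J \<longleftrightarrow> (\<exists>g\<in>L2_elem K. \<forall>u\<in>CR_space k \<T>.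
     J u = (LINT x|lebesgue_on K. g x * u K x))"

text \<open>The trace may be taken from any simplex K adjacent to F.\<close>

definition facet_functional ::
  "nat \<Rightarrow> 'a::euclidean_space set set \<Rightarrow> 'a set \<Rightarrow> ('a broken \<Rightarrow> real) \<Rightarrow> bool" where
  "facet_functional k \<T> F J \<longleftrightarrow> (\<exists>g\<in>poly_on_face (k - 1) F. \<exists>K\<in>\<T>. F \<subseteq> K \<and>
     (\<forall>u\<in>CR_space k \<T>. J u = (LINT x:F|flat_measure F. g x * u K x)))"

definition is_marking :: "'a::euclidean_space set set \<Rightarrow> ('a set \<Rightarrow> 'a set) \<Rightarrow> bool" where
  "is_marking \<T> mark \<longleftrightarrow> (\<forall>K\<in>\<T>. mark K = K) \<and>
     (\<forall>\<tau>\<in>all_faces \<T> - \<T>. mark \<tau> \<in> facets \<T> \<and> \<tau> \<subseteq> mark \<tau>)"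

definition admissible_functionals ::
  "nat \<Rightarrow> 'a::euclidean_space set set \<Rightarrow> ('a set \<Rightarrow> 'a set) \<Rightarrow>
    ('a set \<times> (nat \<Rightarrow> nat) \<Rightarrow> 'a broken \<Rightarrow> real) \<Rightarrow> ('a set \<Rightarrow> 'a broken \<Rightarrow> real) \<Rightarrow> bool" where
  "admissible_functionals k \<T> mark J JCR \<longleftrightarrow>
     (\<forall>(\<tau>, \<alpha>)\<in>index_set k \<T>.
        (mark \<tau> \<in> \<T> \<longrightarrow> elem_functional k \<T> (mark \<tau>) (J (\<tau>, \<alpha>))) \<and>
        (mark \<tau> \<in> facets \<T> \<longrightarrow> facet_functional k \<T> (mark \<tau>) (J (\<tau>, \<alpha>)))) \<and>
     (\<forall>F\<in>facets \<T>. facet_functional k \<T> F (JCR F))"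

definition bidual :: "'i set \<Rightarrow> ('i \<Rightarrow> 'v \<Rightarrow> real) \<Rightarrow> ('i \<Rightarrow> 'v) \<Rightarrow> bool" where
  "bidual I J B \<longleftrightarrow> (\<forall>i\<in>I. \<forall>j\<in>I. J i (B j) = (if i = j then 1 else 0))"

text \<open>The index \<open>Inl (\<tau>, \<alpha>)\<close> belongs to a conforming function, \<open>Inr F\<close> to a facet.\<close>

definition basis_fun :: "nat \<Rightarrow> 'a::euclidean_space set set \<Rightarrow> ('a set \<Rightarrow> nat \<Rightarrow> 'a) \<Rightarrow>
    ('a set \<times> (nat \<Rightarrow> nat)) + 'a set \<Rightarrow> 'a broken" where
  "basis_fun k \<T> A = case_sum (\<lambda>(\<tau>, \<alpha>). B_conf \<T> A \<tau> \<alpha>) (B_CR_facet k)"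

end

theory Submission
  imports Defs "HOL-Computational_Algebra.Field_as_Ring"
    "HOL-Computational_Algebra.Polynomial_Factorial"
begin

text \<open>One facet F suffices. Let g be the density of its functional, y v the barycentric coordinate
  for a vertex v of F, and p the Jacobi polynomial in the definition of the Crouzeix--Raviart
  functions. Slicing F parallel to its face opposite to v shows that \<open>p (1 - 2 * y v)\<close> is orthogonal
  on F to all polynomials of degree less than k, hence to g. The traces on F of the conforming
  functions that g must annihilate span all polynomials of degree at most k vanishing at the
  vertices of F. The sum of \<open>p (1 - 2 * y v)\<close> over the vertices of F takes the value
  \<open>e = d - 1 + p (- 1)\<close> at each of them, so g annihilates this sum minus e, and hence 1, since e
  is not 0. But on F the function \<open>B_CR_facet k F\<close> is 1 minus a multiple of this sum, so g
  annihilates it as well, instead of giving the value 1.\<close>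

section \<open>Jacobi polynomials\<close>

text \<open>The density g has degree at most \<open>k - 1\<close>, just below the Jacobi degree k;
  this is where the restriction on the functionals enters. The Jacobi weight is dictated by
  geometry: F has dimension \<open>d - 1\<close>, so its slice at height \<open>y v\<close> has
  volume proportional to \<open>(1 - y v) ^ (d - 2)\<close>, and
  \<open>1 - y v = (1 + x) / 2\<close> for \<open>x = 1 - 2 * y v\<close>. The number e arises
  because at a vertex of F one coordinate is 1 and the other \<open>d - 1\<close> are 0, while
  \<open>p 1 = 1\<close>. Since \<open>p (- 1)\<close> is plus or minus the binomial coefficient of
  \<open>k + d - 2\<close> over k, its modulus exceeds \<open>d - 1\<close> when
  \<open>d \<ge> 3\<close>. For \<open>d = 2\<close> and odd k, e would be \<open>1 - 1 = 0\<close>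
  and the argument would break down. The laborious part is the span: the conforming functions are
  products of Jacobi factors, to be exchanged for monomials. On F the coordinates of a proper
  subface do not add up to 1, so the exchange for one face is possible only modulo functions of
  larger faces.\<close>

lemma higher_pderiv_linear_power:
  fixes q :: "real poly"
  assumes "i \<le> m"
  shows "\<exists>s. (pderiv ^^ i) ([:- c, 1:] ^ m * q) = [:- c, 1:] ^ (m - i) * s \<and>
    poly s c = fact m / fact (m - i) * poly q c"
  using assms
proof (induction i)
  case 0
  show ?case by (intro exI[of _ q]) auto
next
  case (Suc i)
  then obtain s where s: "(pderiv ^^ i) ([:- c, 1:] ^ m * q) = [:- c, 1:] ^ (m - i) * s"
    "poly s c = fact m / fact (m - i) * poly q c" by auto
  define e where "e = m - Suc i"
  have e: "m - i = Suc e" using Suc.prems by (auto simp: e_def)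
  \<comment> \<open>The product rule keeps the factor \<open>[:- c, 1:] ^ e\<close>; at c the new
    cofactor is \<open>Suc e\<close> times the old one, which builds up the falling
    factorial.\<close>
  have "pderiv ([:- c, 1:] ^ Suc e * s) =
      [:- c, 1:] ^ e * (smult (real (Suc e)) s + [:- c, 1:] * pderiv s)"
    by (simp add: pderiv_mult pderiv_power_Suc pderiv_pCons algebra_simps del: power_Suc of_nat_Suc)
       (simp add: algebra_simps)
  moreover have "fact (m - i) = real (Suc e) * fact e" by (simp add: e)
  ultimately show ?case
    using s unfolding e e_def[symmetric] funpow.simps o_apply s(1)
    by (intro exI[of _ "smult (real (Suc e)) s + [:- c, 1:] * pderiv s"])
       (simp del: of_nat_Suc)
qed

lemma degree_higher_pderiv: 
  fixes p :: "real poly"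
  shows "degree ((pderiv ^^ i) p) = degree p - i"
  by (induction i) (auto simp: degree_pderiv)

lemma integral_pderiv:
  fixes a b :: real
  assumes "a \<le> b"
  shows "integral {a..b} (poly (pderiv p)) = poly p b - poly p a"
  using assms
  by (intro integral_unique fundamental_theorem_of_calculus)
     (auto simp: has_real_derivative_iff_has_vector_derivative[symmetric]
        intro!: DERIV_subset[OF poly_DERIV])

lemma integrable_poly:
  fixes a b :: real
  shows "poly p integrable_on {a..b}"
  by (intro integrable_continuous_real continuous_intros)

lemma integral_pderiv_mult:
  fixes a b :: real
  assumes "a \<le> b" "poly (p * q) a = 0" "poly (p * q) b = 0"
  shows "integral {a..b} (poly (pderiv p * q)) = - integral {a..b} (poly (p * pderiv q))"
proof -
  have "integral {a..b} (poly (pderiv (p * q))) = 0"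
    using integral_pderiv[OF assms(1)] assms by auto
  moreover have "poly (pderiv (p * q)) = (\<lambda>x. poly (pderiv p * q) x + poly (p * pderiv q) x)"
    by (auto simp: pderiv_mult algebra_simps)
  ultimately show ?thesis
    by (simp only: integral_add[OF integrable_poly integrable_poly])
qed

text \<open>Repeated integration by parts: the boundary terms vanish with the lower derivatives of
  U, and i derivatives annihilate q.\<close>

lemma integral_higher_pderiv_mult:
  fixes U q :: "real poly"
  assumes "a \<le> b" "\<And>j. j < i \<Longrightarrow> poly ((pderiv ^^ j) U) a = 0"
    "\<And>j. j < i \<Longrightarrow> poly ((pderiv ^^ j) U) b = 0" "degree q < i"
  shows "integral {a..b} (poly ((pderiv ^^ i) U * q)) = 0"
  using assms(2-)
proof (induction i arbitrary: q)
  case 0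
  then show ?case by simp
next
  case (Suc i)
  \<comment> \<open>For \<open>i = 0\<close> the induction hypothesis would demand a degree below 0;
    there q is constant and the integrand vanishes.\<close>
  have "integral {a..b} (poly ((pderiv ^^ i) U * pderiv q)) = 0"
  proof (cases i)
    case 0
    then have "pderiv q = 0" using Suc.prems by (simp add: pderiv_eq_0_iff)
    then have "poly ((pderiv ^^ i) U * pderiv q) = (\<lambda>x. 0)" by auto
    then show ?thesis by simp
  next
    case (Suc j)
    then show ?thesis using Suc.prems by (intro Suc.IH) (auto simp: degree_pderiv)
  qed
  then show ?case
    using Suc.prems integral_pderiv_mult[OF \<open>a \<le> b\<close>, of "(pderiv ^^ i) U" q]
    by (simp del: poly_mult add: poly_mult[of _ _ a] poly_mult[of _ _ b])
qed

text \<open>Rodrigues' formula: the n-th derivative of \<open>(x - 1) ^ (n + a) * (x + 1) ^ (n + b)\<close> is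
  \<open>(x - 1) ^ a * (x + 1) ^ b\<close> times a multiple of the Jacobi polynomial.\<close>

lemma rodrigues:
  obtains P :: "real poly" where "degree P = n"
    "(pderiv ^^ n) ([:- 1, 1:] ^ (n + a) * [:1, 1:] ^ (n + b)) = [:- 1, 1:] ^ a * [:1, 1:] ^ b * P"
    "poly P 1 = 2 ^ n * fact (n + a) / fact a"
    "poly P (- 1) = (- 2) ^ n * fact (n + b) / fact b"
proof -
  define U :: "real poly" where "U = [:- 1, 1:] ^ (n + a) * [:1, 1:] ^ (n + b)"
  obtain s where s: "(pderiv ^^ n) U = [:- 1, 1:] ^ a * s"
    "poly s 1 = fact (n + a) / fact a * 2 ^ (n + b)"
    using higher_pderiv_linear_power[of n "n + a" 1 "[:1, 1:] ^ (n + b)"] by (auto simp: U_def)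
  obtain s' where s': "(pderiv ^^ n) U = [:1, 1:] ^ b * s'"
    "poly s' (- 1) = fact (n + b) / fact b * (- 2) ^ (n + a)"
    using higher_pderiv_linear_power[of n "n + b" "- 1" "[:- 1, 1:] ^ (n + a)"]
    by (auto simp: U_def mult.commute)
  \<comment> \<open>The zeros at 1 and at -1 give two separate divisors of the derivative;
    coprimality combines them into their product, and cancelling either one yields the end point
    values of P.\<close>
  have "coprime [:- 1, 1:] ([:1, 1:] :: real poly)"
  proof (rule coprimeI)
    fix c :: "real poly" assume "c dvd [:- 1, 1:]" "c dvd [:1, 1:]"
    then have "c dvd [:1, 1:] - [:- 1, 1:]" by (rule dvd_diff[rotated])
    moreover have "([:1, 1:] - [:- 1, 1:] :: real poly) dvd 1" by (simp add: is_unit_pCons_iff)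
    ultimately show "c dvd 1" by (rule dvd_trans)
  qed
  then have "coprime ([:- 1, 1:] ^ a) ([:1, 1:] ^ b :: real poly)" by simp
  then have "[:- 1, 1:] ^ a * [:1, 1:] ^ b dvd (pderiv ^^ n) U"
    by (intro divides_mult) (simp add: s(1), simp add: s'(1))
  then obtain P where P: "(pderiv ^^ n) U = [:- 1, 1:] ^ a * [:1, 1:] ^ b * P" by (auto elim: dvdE)
  have "s = [:1, 1:] ^ b * P" using s(1) P by (auto simp: mult.assoc)
  then have 1: "poly P 1 = 2 ^ n * fact (n + a) / fact a"
    using s(2) by (auto simp: field_simps power_add)
  have "[:1, 1:] ^ b * s' = [:1, 1:] ^ b * ([:- 1, 1:] ^ a * P)"
    using s'(1) P by (simp add: mult_ac)
  then have "s' = [:- 1, 1:] ^ a * P" by (subst (asm) mult_cancel_left) auto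
  then have "fact (n + b) / fact b * (- 2) ^ (n + a) = (- 2) ^ a * poly P (- 1)"
    using s'(2) by simp
  then have "(- 2) ^ a * ((- 2) ^ n * fact (n + b) / fact b) = (- 2) ^ a * poly P (- 1)"
    by (simp add: power_add field_simps)
  then have 2: "poly P (- 1) = (- 2) ^ n * fact (n + b) / fact b"
    by (subst (asm) mult_cancel_left) auto
  have "P \<noteq> 0" using 1 by auto
  \<comment> \<open>Degree count: U has degree \<open>2 * n + a + b\<close>, and n derivatives leave
    \<open>n + a + b\<close>.\<close>
  then have "degree ((pderiv ^^ n) U) = a + b + degree P"
    unfolding P by (simp add: degree_mult_eq degree_power_eq)
  moreover have "degree U = n + a + (n + b)"
    unfolding U_def by (simp add: degree_mult_eq degree_power_eq)
  ultimately have "degree P = n" by (simp add: degree_higher_pderiv)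
  with P 1 2 show ?thesis using that unfolding U_def by blast
qed

lemma jacobi_exists:
  obtains p where "degree p = n"
    "\<And>q. degree q < n \<Longrightarrow>
      integral {-1..1} (\<lambda>x. poly p x * poly q x * ((1 - x) ^ a * (1 + x) ^ b)) = 0"
    "poly p 1 = pochhammer (real a + 1) n / fact n"
    "poly p (- 1) = (- 1) ^ n * fact (n + b) / (fact n * fact b)"
proof -
  define U :: "real poly" where "U = [:- 1, 1:] ^ (n + a) * [:1, 1:] ^ (n + b)"
  obtain P where P: "degree P = n" "(pderiv ^^ n) U = [:- 1, 1:] ^ a * [:1, 1:] ^ b * P"
    "poly P 1 = 2 ^ n * fact (n + a) / fact a"
    "poly P (- 1) = (- 2) ^ n * fact (n + b) / fact b"
    using rodrigues[of n a b] unfolding U_def by metis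
  \<comment> \<open>This scaling produces the prescribed value at 1. The customary sign
    \<open>(- 1) ^ n\<close> is absent because U is built from \<open>x - 1\<close> rather than
    \<open>1 - x\<close>.\<close>
  define p where "p = smult (1 / (2 ^ n * fact n)) P"
  have orth: "integral {-1..1} (\<lambda>x. poly p x * poly q x * ((1 - x) ^ a * (1 + x) ^ b)) = 0"
    if "degree q < n" for q
  proof -
    have "poly ((pderiv ^^ j) U) 1 = 0" if "j < n" for j
    proof -
      obtain s where "(pderiv ^^ j) U = [:- 1, 1:] ^ (n + a - j) * s"
        using higher_pderiv_linear_power[of j "n + a" 1 "[:1, 1:] ^ (n + b)"] that
        unfolding U_def by fastforce
      then show ?thesis using that by simp
    qed
    moreover have "poly ((pderiv ^^ j) U) (- 1) = 0" if "j < n" for j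
    proof -
      obtain s where "(pderiv ^^ j) U = [:1, 1:] ^ (n + b - j) * s"
        using higher_pderiv_linear_power[of j "n + b" "- 1" "[:- 1, 1:] ^ (n + a)"] that
        unfolding U_def mult.commute[of "[:- 1, 1:] ^ (n + a)"] by fastforce
      then show ?thesis using that by simp
    qed
    ultimately have "integral {-1..1} (poly ((pderiv ^^ n) U * q)) = 0"
      using that by (intro integral_higher_pderiv_mult) auto
    moreover have "(\<lambda>x. poly p x * poly q x * ((1 - x) ^ a * (1 + x) ^ b)) =
        (\<lambda>x. ((- 1) ^ a / (2 ^ n * fact n)) * poly ((pderiv ^^ n) U * q) x)"
    proof
      fix x :: real
      have "(1 - x) ^ a = (- 1) ^ a * (x - 1) ^ a"
        by (subst power_mult_distrib[symmetric]) simp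
      then show "poly p x * poly q x * ((1 - x) ^ a * (1 + x) ^ b) =
        ((- 1) ^ a / (2 ^ n * fact n)) * poly ((pderiv ^^ n) U * q) x"
        unfolding P(2) p_def by simp
    qed
    ultimately show ?thesis by (simp only: integral_mult_right)
  qed
  have "poly p 1 = pochhammer (real a + 1) n / fact n"
  proof -
    have "fact (n + a) = fact a * pochhammer (real a + 1) n"
      using pochhammer_product'[of "1 :: real" a n] by (simp add: pochhammer_fact add.commute)
    then show ?thesis using P(3) by (simp add: p_def)
  qed
  moreover have "poly p (- 1) = (- 1) ^ n * fact (n + b) / (fact n * fact b)"
    using P(4) by (simp add: p_def power_minus[of 2] field_simps)
  ultimately show ?thesis using that[of p] P(1) orth by (auto simp: p_def)
qed

text \<open>Cancelling the leading coefficients leaves a polynomial r of degree less than n that is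
  orthogonal to itself. The weight is nonnegative and has finitely many zeros, so r is 0; the common
  nonzero value at 1 then fixes the scalar.\<close>

lemma jacobi_unique:
  fixes p q :: "real poly"
  assumes p: "degree p = n" "poly p 1 = c"
    "\<And>r. degree r < n \<Longrightarrow>
      integral {-1..1} (\<lambda>x. poly p x * poly r x * ((1 - x) ^ a * (1 + x) ^ b)) = 0"
    and q: "degree q = n" "poly q 1 = c"
    "\<And>r. degree r < n \<Longrightarrow>
      integral {-1..1} (\<lambda>x. poly q x * poly r x * ((1 - x) ^ a * (1 + x) ^ b)) = 0"
    and "c \<noteq> 0"
  shows "p = q"
proof -
  have nz: "p \<noteq> 0" "q \<noteq> 0" using assms by auto
  define e where "e = lead_coeff p / lead_coeff q"
  define r where "r = p - smult e q"
  have "r = 0"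
  proof (rule ccontr)
    assume "r \<noteq> 0"
    have "degree r \<le> n" unfolding r_def using p q by (intro degree_diff_le) auto
    moreover have "coeff q n \<noteq> 0" using q(1) nz by (metis leading_coeff_0_iff)
    then have "coeff r n = 0" using p(1) q(1) by (simp add: r_def e_def)
    ultimately have r: "degree r < n"
      using \<open>r \<noteq> 0\<close> by (metis leading_coeff_0_iff le_neq_implies_less)
    define w where "w = [:1, -1:] ^ a * [:1, 1 :: real:] ^ b"
    have int: "integral {-1..1} (poly (s * r * w)) =
        integral {-1..1} (\<lambda>x. poly s x * poly r x * ((1 - x) ^ a * (1 + x) ^ b))" for s
      by (intro arg_cong[of _ _ "integral {-1..1}"] ext) (simp add: w_def)
    have "poly (r * r * w) = (\<lambda>x. poly (p * r * w) x - e * poly (q * r * w) x)"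
      by (auto simp: r_def left_diff_distrib)
    then have "integral {-1..1} (poly (r * r * w)) =
        integral {-1..1} (poly (p * r * w)) - e * integral {-1..1} (poly (q * r * w))"
      by (simp only: integral_diff[OF integrable_poly integrable_on_mult_right[OF integrable_poly]]
          integral_mult_right)
    also have "\<dots> = 0" unfolding int using p(3)[OF r] q(3)[OF r] by simp
    finally have "(poly (r * r * w) has_integral 0) (cbox (- 1) 1)"
      using integrable_integral[OF integrable_poly[of "r * r * w" "- 1" 1]] by simp
    moreover have "continuous_on (cbox (- 1) 1) (poly (r * r * w))"
      by (intro continuous_intros)
    moreover have "poly (r * r * w) x \<ge> 0" if "x \<in> cbox (- 1) 1" for x
      using that by (simp add: w_def)
    ultimately have zero: "poly (r * r * w) x = 0" if "x \<in> cbox (- 1) 1" for x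
      using that by (intro has_integral_0_cbox_imp_0[of "- 1" 1 "poly (r * r * w)"]) auto
    have "{-1..1} \<subseteq> {x. poly (r * r * w) x = 0}"
      by (intro subsetI CollectI, rule zero) simp
    moreover have "r * r * w \<noteq> 0" using \<open>r \<noteq> 0\<close> by (auto simp: w_def)
    ultimately have "finite {-1..1 :: real}"
      using poly_roots_finite finite_subset by blast
    then show False by (simp add: infinite_Icc)
  qed
  then have pq: "p = smult e q" by (simp add: r_def)
  then have "c = e * c" using p(2) q(2) by simp
  then show ?thesis using pq \<open>c \<noteq> 0\<close> by simp
qed

text \<open>The value at -1 is no part of the definition; it is read off the Rodrigues witness once
  uniqueness identifies that witness with \<open>jacobi\<close>.\<close>

lemma jacobi_properties:
  shows degree_jacobi: "degree (jacobi a b n) = n"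
    and jacobi_orthogonal: "\<And>q. degree q < n \<Longrightarrow>
      integral {-1..1} (\<lambda>x. poly (jacobi a b n) x * poly q x * ((1 - x) ^ a * (1 + x) ^ b)) = 0"
    and poly_jacobi_1: "poly (jacobi a b n) 1 = pochhammer (real a + 1) n / fact n"
    and poly_jacobi_minus_1:
      "poly (jacobi a b n) (- 1) = (- 1) ^ n * fact (n + b) / (fact n * fact b)"
proof -
  let ?P = "\<lambda>p. degree p = n \<and> (\<forall>q. degree q < n \<longrightarrow>
      integral {-1..1} (\<lambda>x. poly p x * poly q x * ((1 - x) ^ a * (1 + x) ^ b)) = 0) \<and>
      poly p 1 = pochhammer (real a + 1) n / fact n"
  obtain p where p: "?P p" "poly p (- 1) = (- 1) ^ n * fact (n + b) / (fact n * fact b)"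
    by (rule jacobi_exists[of n a b]) blast
  have "pochhammer (real a + 1) n / fact n \<noteq> 0"
    using pochhammer_pos[of "real a + 1" n] by simp
  then have unique: "q = p" if "?P q" for q using p that by (intro jacobi_unique[of q n "poly p 1" a b p]) simp_all
  have *: "jacobi a b n = p" unfolding jacobi_def by (rule the_equality[where P = ?P, OF p(1) unique])
  show "degree (jacobi a b n) = n"
    "\<And>q. degree q < n \<Longrightarrow>
      integral {-1..1} (\<lambda>x. poly (jacobi a b n) x * poly q x * ((1 - x) ^ a * (1 + x) ^ b)) = 0"
    "poly (jacobi a b n) 1 = pochhammer (real a + 1) n / fact n"
    "poly (jacobi a b n) (- 1) = (- 1) ^ n * fact (n + b) / (fact n * fact b)"
    unfolding * using p by blast+
qed

section \<open>The measure on a facet\<close>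

text \<open>Boxes determine the product measure, and the preimage of a box under a coordinatewise
  affine map is a box, so scaling on the line suffices. The restriction to B keeps the map inside
  the extensional functions on which the product measure lives.\<close>

lemma PiM_lborel_affine:
  fixes c :: "'i \<Rightarrow> real"
  assumes "finite B" "0 < r"
  defines "M \<equiv> \<Pi>\<^sub>M b\<in>B. (lborel :: real measure)"
  shows "density (distr M M (\<lambda>t. \<lambda>b\<in>B. c b + r * t b)) (\<lambda>_. ennreal (r ^ card B)) = M"
proof -
  interpret product_sigma_finite "\<lambda>_::'i. lborel :: real measure" by standard
  have meas: "(\<lambda>t. \<lambda>b\<in>B. c b + r * t b) \<in> measurable M M" unfolding M_def by measurable
  show ?thesis unfolding M_def
  proof (rule PiM_eqI[OF \<open>finite B\<close>])
    fix E :: "'i \<Rightarrow> real set" assume E: "\<And>i. i \<in> B \<Longrightarrow> E i \<in> sets lborel"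
    then have PE: "Pi\<^sub>E B E \<in> sets M" unfolding M_def using \<open>finite B\<close> by (auto intro: sets_PiM_I_finite)
    have pre: "(\<lambda>x. c b + r * x) -` E b \<in> sets lborel" if "b \<in> B" for b
      using measurable_sets[of "\<lambda>x. c b + r * x" borel borel "E b"] E[OF that] by simp
    have one: "ennreal r * emeasure lborel ((\<lambda>x. c b + r * x) -` E b) = emeasure lborel (E b)" if "b \<in> B" for b
      using E[OF that] \<open>0 < r\<close>
      by (subst (2) lborel_real_affine[of r "c b"])
         (auto simp: emeasure_density emeasure_distr nn_integral_cmult nn_integral_distr)
    have "(\<lambda>t. \<lambda>b\<in>B. c b + r * t b) -` Pi\<^sub>E B E \<inter> space M = Pi\<^sub>E B (\<lambda>b. (\<lambda>x. c b + r * x) -` E b)"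
      unfolding M_def by (auto simp: space_PiM PiE_iff)
    then have "emeasure (distr M M (\<lambda>t. \<lambda>b\<in>B. c b + r * t b)) (Pi\<^sub>E B E) =
        (\<Prod>b\<in>B. emeasure lborel ((\<lambda>x. c b + r * x) -` E b))"
      using PE meas pre \<open>finite B\<close> by (simp add: emeasure_distr M_def emeasure_PiM)
    then have "emeasure (density (distr M M (\<lambda>t. \<lambda>b\<in>B. c b + r * t b)) (\<lambda>_. ennreal (r ^ card B))) (Pi\<^sub>E B E) =
        ennreal (r ^ card B) * (\<Prod>b\<in>B. emeasure lborel ((\<lambda>x. c b + r * x) -` E b))"
      using PE by (simp add: emeasure_density_const)
    also have "\<dots> = (\<Prod>b\<in>B. ennreal r * emeasure lborel ((\<lambda>x. c b + r * x) -` E b))"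
      using \<open>0 < r\<close> by (simp add: prod.distrib ennreal_power)
    also have "\<dots> = (\<Prod>b\<in>B. emeasure lborel (E b))" using one by (intro prod.cong) auto
    finally show "emeasure (density (distr (\<Pi>\<^sub>M b\<in>B. lborel) (\<Pi>\<^sub>M b\<in>B. lborel) (\<lambda>t. \<lambda>b\<in>B. c b + r * t b))
      (\<lambda>_. ennreal (r ^ card B))) (Pi\<^sub>E B E) = (\<Prod>i\<in>B. emeasure lborel (E i))"
      unfolding M_def .
  qed simp
qed

lemma integral_PiM_lborel_affine:
  fixes c :: "'i \<Rightarrow> real" and f :: "('i \<Rightarrow> real) \<Rightarrow> real"
  assumes "finite B" "0 < r" and f: "f \<in> borel_measurable (\<Pi>\<^sub>M b\<in>B. lborel)"
  shows "(LINT t|(\<Pi>\<^sub>M b\<in>B. lborel). f t) =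
    r ^ card B * (LINT t|(\<Pi>\<^sub>M b\<in>B. lborel). f (\<lambda>b\<in>B. c b + r * t b))"
proof -
  let ?M = "\<Pi>\<^sub>M b\<in>B. (lborel :: real measure)"
  have meas: "(\<lambda>t. \<lambda>b\<in>B. c b + r * t b) \<in> measurable ?M ?M" by measurable
  have "(LINT t|?M. f t) =
      (LINT t|density (distr ?M ?M (\<lambda>t. \<lambda>b\<in>B. c b + r * t b)) (\<lambda>_. ennreal (r ^ card B)). f t)"
    using PiM_lborel_affine[OF assms(1,2), of c] by simp
  also have "\<dots> = (LINT t|distr ?M ?M (\<lambda>t. \<lambda>b\<in>B. c b + r * t b). r ^ card B *\<^sub>R f t)"
    using f \<open>0 < r\<close> by (intro integral_density) auto
  also have "\<dots> = (LINT t|?M. r ^ card B *\<^sub>R f (\<lambda>b\<in>B. c b + r * t b))"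
    using f meas by (intro integral_distr) auto
  finally show ?thesis by simp
qed

lemma tangent_basis_properties:
  fixes F :: "'a::euclidean_space set"
  shows "pairwise orthogonal (tangent_basis F)" "\<And>b. b \<in> tangent_basis F \<Longrightarrow> norm b = 1"
    "span (tangent_basis F) = span {x - y |x y. x \<in> F \<and> y \<in> F}"
    "finite (tangent_basis F)"
    "card (tangent_basis F) = dim {x - y |x y. x \<in> F \<and> y \<in> F}"
proof -
  let ?S = "span {x - y |x y. x \<in> F \<and> y \<in> F}" and ?B = "tangent_basis F"
  obtain B where "pairwise orthogonal B" "\<And>b. b \<in> B \<Longrightarrow> norm b = 1" "span B = ?S"
    by (rule orthonormal_basis_subspace[OF subspace_span]) blast
  then have "\<exists>B. pairwise orthogonal B \<and> (\<forall>b\<in>B. norm b = 1) \<and> span B = ?S" by blast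
  then have B: "pairwise orthogonal ?B \<and> (\<forall>b\<in>?B. norm b = 1) \<and> span ?B = ?S"
    unfolding tangent_basis_def by (rule someI_ex)
  then show *: "pairwise orthogonal ?B" "\<And>b. b \<in> ?B \<Longrightarrow> norm b = 1" "span ?B = ?S" by blast+
  have "0 \<notin> ?B" using *(2)[of 0] by auto
  with *(1) have "independent ?B" by (rule pairwise_orthogonal_independent)
  then show "finite ?B" "card ?B = dim {x - y |x y. x \<in> F \<and> y \<in> F}"
    using dim_eq_card[OF *(3)] by (auto simp: independent_imp_finite)
qed

lemma card_tangent_basis:
  fixes F :: "'a::euclidean_space set"
  assumes "a \<in> F"
  shows "int (card (tangent_basis F)) = aff_dim F"
proof -
  have "span {x - y |x y. x \<in> F \<and> y \<in> F} = span ((\<lambda>x. - a + x) ` F)"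
  proof (rule span_eq[THEN iffD2], intro conjI subsetI)
    fix u assume "u \<in> {x - y |x y. x \<in> F \<and> y \<in> F}"
    then obtain x y where "u = (- a + x) - (- a + y)" "x \<in> F" "y \<in> F" by auto
    then show "u \<in> span ((\<lambda>x. - a + x) ` F)" by (metis imageI span_base span_diff)
  next
    fix u assume "u \<in> (\<lambda>x. - a + x) ` F"
    then show "u \<in> span {x - y |x y. x \<in> F \<and> y \<in> F}" using assms by (force intro!: span_base)
  qed
  then have "dim {x - y |x y. x \<in> F \<and> y \<in> F} = dim ((\<lambda>x. - a + x) ` F)" by (rule span_eq_dim)
  then show ?thesis
    unfolding tangent_basis_properties(5) aff_dim_eq_dim[OF hull_inc[OF assms]] by simp
qed

lemma flat_measure_param_measurable:
  fixes F :: "'a::euclidean_space set"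
  shows "(\<lambda>t. a + (\<Sum>b\<in>tangent_basis F. t b *\<^sub>R b)) \<in>
    borel_measurable (\<Pi>\<^sub>M b\<in>tangent_basis F. (lborel :: real measure))"
proof -
  have "(\<lambda>t. t b) \<in> borel_measurable (\<Pi>\<^sub>M b\<in>tangent_basis F. (lborel :: real measure))"
    if "b \<in> tangent_basis F" for b
    using measurable_component_singleton[OF that, of "\<lambda>_. lborel :: real measure"] by simp
  then show ?thesis
    by (intro borel_measurable_add borel_measurable_sum borel_measurable_scaleR
        borel_measurable_const)
qed

lemma space_flat_measure [simp]: "space (flat_measure F) = UNIV"
  and sets_flat_measure [simp, measurable_cong]: "sets (flat_measure F) = sets borel"
  by (simp_all add: flat_measure_def)

text \<open>In the orthonormal coordinates of the flat, a dilation about z scales every coordinate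
  by r and shifts it. That z lies in F ensures that its difference from the base point expands in
  the tangent basis.\<close>

lemma integral_flat_measure_dilation:
  fixes F :: "'a::euclidean_space set" and f :: "'a \<Rightarrow> real"
  assumes "z \<in> F" "0 < r" and f: "f \<in> borel_measurable borel"
  shows "(LINT x|flat_measure F. f x) =
    r ^ card (tangent_basis F) * (LINT x|flat_measure F. f (z + r *\<^sub>R (x - z)))"
proof -
  let ?B = "tangent_basis F" and ?M = "\<Pi>\<^sub>M b\<in>tangent_basis F. (lborel :: real measure)"
  define a where "a = (SOME a. a \<in> F)"
  define \<psi> where "\<psi> t = a + (\<Sum>b\<in>?B. t b *\<^sub>R b)" for t
  have \<psi>: "\<psi> \<in> borel_measurable ?M" unfolding \<psi>_def by (rule flat_measure_param_measurable)
  have fm: "flat_measure F = distr ?M borel \<psi>"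
    unfolding flat_measure_def \<psi>_def a_def by (simp add: fun_eq_iff)
  have "a \<in> F" unfolding a_def using assms(1) by (rule someI)
  then have "z - a \<in> span ?B" unfolding tangent_basis_properties(3) using assms(1) by (intro span_base) auto
  then have za: "(\<Sum>b\<in>?B. ((z - a) \<bullet> b) *\<^sub>R b) = z - a"
    by (intro orthonormal_basis_expand tangent_basis_properties)
  \<comment> \<open>The shift that solves \<open>\<psi> t' = z + r *\<^sub>R (\<psi> t - z)\<close>
    for the coordinates \<open>t'\<close>.\<close>
  define c where "c b = (1 - r) * ((z - a) \<bullet> b)" for b
  have "\<psi> (\<lambda>b\<in>?B. c b + r * t b) = z + r *\<^sub>R (\<psi> t - z)" for t
  proof -
    have "\<psi> (\<lambda>b\<in>?B. c b + r * t b) = a + (\<Sum>b\<in>?B. (1 - r) *\<^sub>R (((z - a) \<bullet> b) *\<^sub>R b) + r *\<^sub>R (t b *\<^sub>R b))"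
      unfolding \<psi>_def by (auto intro!: sum.cong simp: c_def scaleR_add_left)
    also have "\<dots> = a + (1 - r) *\<^sub>R (z - a) + r *\<^sub>R (\<Sum>b\<in>?B. t b *\<^sub>R b)"
      by (simp add: sum.distrib scaleR_sum_right[symmetric] za del: scaleR_scaleR)
    finally show ?thesis by (simp add: \<psi>_def algebra_simps)
  qed
  moreover have "(LINT t|?M. f (\<psi> t)) = r ^ card ?B * (LINT t|?M. f (\<psi> (\<lambda>b\<in>?B. c b + r * t b)))"
    using f \<psi> assms(2)
    by (intro integral_PiM_lborel_affine tangent_basis_properties) auto
  moreover have "(\<lambda>x. f (z + r *\<^sub>R (x - z))) \<in> borel_measurable borel"
    using f by measurable
  ultimately show ?thesis unfolding fm using f \<psi> by (simp add: integral_distr)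
qed

text \<open>By orthonormality each coordinate of a point of F is bounded by its distance from the
  base point, so the preimage of F lies in a box.\<close>

lemma emeasure_flat_measure_finite:
  fixes F :: "'a::euclidean_space set"
  assumes "bounded F" "closed F"
  shows "emeasure (flat_measure F) F < \<infinity>"
proof (cases "F = {}")
  case False
  let ?B = "tangent_basis F" and ?M = "\<Pi>\<^sub>M b\<in>tangent_basis F. (lborel :: real measure)"
  interpret product_sigma_finite "\<lambda>_::'a. lborel :: real measure" by standard
  define a where "a = (SOME a. a \<in> F)"
  define \<psi> where "\<psi> t = a + (\<Sum>b\<in>?B. t b *\<^sub>R b)" for t
  have \<psi>: "\<psi> \<in> borel_measurable ?M" unfolding \<psi>_def by (rule flat_measure_param_measurable)
  have fm: "flat_measure F = distr ?M borel \<psi>"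
    unfolding flat_measure_def \<psi>_def a_def by (simp add: fun_eq_iff)
  obtain R where R: "\<And>x. x \<in> F \<Longrightarrow> norm (x - a) \<le> R"
    using assms(1) unfolding bounded_any_center[where a = a] by (auto simp: dist_norm norm_minus_commute)
  have coord: "(\<psi> t - a) \<bullet> b = t b" if "b \<in> ?B" for t b
  proof -
    have "(\<psi> t - a) \<bullet> b = (\<Sum>b'\<in>?B. t b' * (b' \<bullet> b))" by (simp add: \<psi>_def inner_sum_left)
    also have "\<dots> = (\<Sum>b'\<in>?B. if b' = b then t b else 0)"
      using that tangent_basis_properties(1,2)[where F = F]
      by (intro sum.cong) (auto simp: pairwise_def orthogonal_def norm_eq_1)
    finally show ?thesis using that tangent_basis_properties(4)[of F] by simp
  qed
  have "emeasure (flat_measure F) F = emeasure ?M (\<psi> -` F \<inter> space ?M)"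
    unfolding fm using \<psi> assms by (simp add: emeasure_distr borel_closed)
  also have "\<dots> \<le> emeasure ?M (Pi\<^sub>E ?B (\<lambda>_. {- R..R}))"
  proof (rule emeasure_mono)
    show "\<psi> -` F \<inter> space ?M \<subseteq> Pi\<^sub>E ?B (\<lambda>_. {- R..R})"
    proof
      fix t assume t: "t \<in> \<psi> -` F \<inter> space ?M"
      have "\<bar>t b\<bar> \<le> R" if b: "b \<in> ?B" for b
        using coord[OF b, of t] Cauchy_Schwarz_ineq2[of "\<psi> t - a" b] R[of "\<psi> t"] t
          tangent_basis_properties(2)[OF b] by auto
      then show "t \<in> Pi\<^sub>E ?B (\<lambda>_. {- R..R})" using t by (force simp: space_PiM PiE_iff abs_le_iff)
    qed
  qed (auto intro: sets_PiM_I_finite tangent_basis_properties)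
  also have "\<dots> < \<infinity>"
    using tangent_basis_properties(4)[of F]
    by (simp add: emeasure_PiM emeasure_lborel_Icc_eq ennreal_power)
  finally show ?thesis .
qed simp

lemma set_integrable_flat_measure:
  fixes F :: "'a::euclidean_space set" and f :: "'a \<Rightarrow> real"
  assumes "compact F" "continuous_on F f"
  shows "set_integrable (flat_measure F) F f"
proof -
  obtain C where "\<And>x. x \<in> F \<Longrightarrow> \<bar>f x\<bar> \<le> C"
    using compact_imp_bounded[OF compact_continuous_image[OF assms(2,1)]]
    by (auto simp: bounded_iff)
  moreover have "(\<lambda>x. indicator F x *\<^sub>R f x) \<in> borel_measurable borel"
    using assms by (intro borel_measurable_continuous_on_indicator) (auto intro: borel_closed compact_imp_closed)
  then have "set_borel_measurable (flat_measure F) F f"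
    unfolding set_borel_measurable_def by simp
  ultimately show ?thesis
    using assms emeasure_flat_measure_finite[of F]
    unfolding set_integrable_def
    by (intro integrableI_bounded_set[where A = F and B = C])
       (auto simp: compact_imp_bounded compact_imp_closed set_borel_measurable_def borel_closed)
qed

section \<open>Integration over a facet by layers\<close>

lemma integral_poly_tail:
  fixes q :: "real poly"
  assumes "s \<in> {0..1}"
  shows "(LINT r|restrict_space lborel {0..1}. (if s \<le> r then 1 else 0) * poly (pderiv q) r) =
    poly q 1 - poly q s"
proof -
  have "(LINT r|restrict_space lborel {0..1}. (if s \<le> r then 1 else 0) * poly (pderiv q) r) =
      (LINT r|lborel. indicator {0..1} r *\<^sub>R ((if s \<le> r then 1 else 0) * poly (pderiv q) r))"
    by (intro integral_restrict_space) simp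
  also have "\<dots> = (LINT r|lborel. poly (pderiv q) r * indicator {s..1} r)"
    using assms by (intro Bochner_Integration.integral_cong) (auto simp: indicator_def)
  also have "\<dots> = poly q 1 - poly q s"
    using assms by (intro integral_FTC_Icc_real poly_DERIV poly_isCont) auto
  finally show ?thesis .
qed

lemma integral_poly_by_parts:
  fixes p q :: "real poly"
  assumes "a \<le> b"
  shows "integral {a..b} (poly (pderiv p * q)) =
    poly (p * q) b - poly (p * q) a - integral {a..b} (poly (p * pderiv q))"
proof -
  have "poly (pderiv (p * q)) = (\<lambda>x. poly (pderiv p * q) x + poly (p * pderiv q) x)"
    by (auto simp: pderiv_mult algebra_simps)
  then show ?thesis
    using integral_pderiv[OF assms, of "p * q"]
    by (simp only: integral_add[OF integrable_poly integrable_poly])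
qed

text \<open>Integration by layers: \<open>poly q (s x) = poly q 1 - (\<integral>r\<in>{s x..1}. poly (pderiv q) r)\<close>.\<close>

lemma set_integral_poly_layers:
  fixes F :: "'a::euclidean_space set" and s g :: "'a \<Rightarrow> real"
  assumes F: "compact F" and s: "continuous_on UNIV s" "\<And>x. x \<in> F \<Longrightarrow> s x \<in> {0..1}"
    and g: "continuous_on UNIV g"
    and layer: "\<And>r. 0 < r \<Longrightarrow> r \<le> 1 \<Longrightarrow>
      (LINT x:F|flat_measure F. indicator {x. s x \<le> r} x * g x) = poly \<Phi> r"
    and "poly \<Phi> 0 = 0"
  shows "(LINT x:F|flat_measure F. g x * poly q (s x)) = integral {0..1} (poly (q * pderiv \<Phi>))"
proof -
  \<comment> \<open>Restricted to F and to the unit interval both measures are finite, so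
    boundedness and measurability of the integrand suffice for Fubini.\<close>
  define N where "N = restrict_space (flat_measure F) F"
  define L where "L = restrict_space lborel {0..1 :: real}"
  have closed: "closed F" "bounded F" using F compact_imp_closed compact_imp_bounded by auto
  have setF: "F \<inter> space (flat_measure F) \<in> sets (flat_measure F)"
    using closed by (simp add: borel_closed)
  have N_meas: "f \<in> borel_measurable N" if "f \<in> borel_measurable borel" for f :: "'a \<Rightarrow> real"
    unfolding N_def using that by (intro measurable_restrict_space1) simp
  have sg: "s \<in> borel_measurable borel" "g \<in> borel_measurable borel"
    using s g by (auto intro: borel_measurable_continuous_onI)
  note [measurable] = N_meas[OF sg(1)] N_meas[OF sg(2)]
  have spaceN: "space N = F" unfolding N_def using setF by (simp add: space_restrict_space)
  interpret N: finite_measure N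
    using emeasure_flat_measure_finite[OF closed(2,1)] setF
    by (intro finite_measureI) (simp add: N_def space_restrict_space emeasure_restrict_space less_top)
  interpret L: finite_measure L
    by (intro finite_measureI) (simp add: L_def space_restrict_space emeasure_restrict_space)
  interpret pair_sigma_finite N L ..
  interpret NL: finite_measure "N \<Otimes>\<^sub>M L"
    by (intro finite_measure_pair_measure N.finite_measure_axioms L.finite_measure_axioms)
  have L_meas [measurable]: "(\<lambda>r. r) \<in> borel_measurable L"
    unfolding L_def by (intro measurable_restrict_space1) simp
  have q_meas [measurable]: "poly p \<in> borel_measurable borel" for p :: "real poly"
    by (intro borel_measurable_continuous_onI continuous_intros)
  have intF: "(LINT x|N. f x) = (LINT x:F|flat_measure F. f x)" for f :: "'a \<Rightarrow> real"
    unfolding N_def set_lebesgue_integral_def by (rule integral_restrict_space[OF setF])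
  \<comment> \<open>Integrating over r first gives the values of q by the fundamental theorem;
    integrating over x first gives the layers.\<close>
  define f where "f x r = (if s x \<le> r then 1 else 0) * poly (pderiv q) r * g x" for x r
  have bounded: "\<exists>C. \<forall>x\<in>S. \<bar>h x\<bar> \<le> C"
    if "compact S" "continuous_on UNIV h" for S :: "'b::topological_space set" and h :: "'b \<Rightarrow> real"
    using compact_imp_bounded[OF compact_continuous_image[OF continuous_on_subset[OF that(2)] that(1)]]
    by (auto simp: bounded_iff)
  obtain Cg where Cg: "\<And>x. x \<in> F \<Longrightarrow> \<bar>g x\<bar> \<le> Cg" using bounded[OF F g] by blast
  obtain Cq where Cq: "\<And>r. r \<in> {0..1} \<Longrightarrow> \<bar>poly (pderiv q) r\<bar> \<le> Cq"
    using bounded[OF compact_Icc[of 0 1], of "poly (pderiv q)"] continuous_on_poly[OF continuous_on_id]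
    by blast
  have "integrable (N \<Otimes>\<^sub>M L) (case_prod f)"
  proof (rule NL.integrable_const_bound)
    have "\<bar>f x r\<bar> \<le> Cq * Cg" if "x \<in> F" "r \<in> {0..1}" for x r
    proof -
      have "\<bar>f x r\<bar> \<le> \<bar>poly (pderiv q) r\<bar> * \<bar>g x\<bar>" by (simp add: f_def abs_mult)
      also have "\<dots> \<le> Cq * Cg"
        using Cg[OF that(1)] Cq[OF that(2)] by (intro mult_mono) auto
      finally show ?thesis .
    qed
    then show "AE z in N \<Otimes>\<^sub>M L. norm (case_prod f z) \<le> Cq * Cg"
      by (intro AE_I2) (auto simp: space_pair_measure spaceN L_def space_restrict_space)
    show "case_prod f \<in> borel_measurable (N \<Otimes>\<^sub>M L)"
      unfolding f_def case_prod_beta' by measurable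
  qed
  then have "(LINT r|L. LINT x|N. f x r) = (LINT x|N. LINT r|L. f x r)"
    by (rule Fubini_integral)
  also have "(LINT x|N. LINT r|L. f x r) = (LINT x|N. (poly q 1 - poly q (s x)) * g x)"
    using s(2) by (intro Bochner_Integration.integral_cong)
      (simp_all add: f_def L_def integral_poly_tail spaceN)
  also have "\<dots> = (LINT x|N. poly q 1 * g x - g x * poly q (s x))"
    by (simp add: algebra_simps)
  also have "\<dots> = poly q 1 * (LINT x:F|flat_measure F. g x) - (LINT x:F|flat_measure F. g x * poly q (s x))"
  proof -
    have int: "integrable N h" if "continuous_on UNIV h" for h :: "'a \<Rightarrow> real"
      using set_integrable_flat_measure[OF F continuous_on_subset[OF that subset_UNIV]] setF
      unfolding N_def set_integrable_def by (subst integrable_restrict_space) auto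
    have "(LINT x|N. poly q 1 * g x - g x * poly q (s x)) =
        (LINT x|N. poly q 1 * g x) - (LINT x|N. g x * poly q (s x))"
      using s g by (intro Bochner_Integration.integral_diff int continuous_intros) auto
    then show ?thesis unfolding intF by simp
  qed
  also have "(LINT x:F|flat_measure F. g x) = poly \<Phi> 1"
  proof -
    have "(LINT x:F|flat_measure F. g x) = (LINT x:F|flat_measure F. indicator {x. s x \<le> 1} x * g x)"
      using s(2) setF by (intro set_lebesgue_integral_cong) auto
    then show ?thesis using layer[of 1] by simp
  qed
  finally have main: "(LINT r|L. LINT x|N. f x r) =
      poly q 1 * poly \<Phi> 1 - (LINT x:F|flat_measure F. g x * poly q (s x))" .
  have "(LINT r|L. LINT x|N. f x r) = (LINT r|L. poly (pderiv q * \<Phi>) r)"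
  proof (rule integral_cong_AE)
    show "(\<lambda>r. LINT x|N. f x r) \<in> borel_measurable L"
    proof (rule N.borel_measurable_lebesgue_integral)
      show "(\<lambda>(r, x). f x r) \<in> borel_measurable (L \<Otimes>\<^sub>M N)"
        unfolding f_def case_prod_beta' by measurable
    qed
    show "(\<lambda>r. poly (pderiv q * \<Phi>) r) \<in> borel_measurable L" by measurable
    have "(LINT x|N. f x r) = poly (pderiv q * \<Phi>) r" if "0 < r" "r \<le> 1" for r
    proof -
      have "(LINT x|N. f x r) =
          (LINT x:F|flat_measure F. poly (pderiv q) r * (indicator {x. s x \<le> r} x * g x))"
        unfolding intF f_def by (simp add: indicator_def of_bool_def mult_ac)
      also have "\<dots> = poly (pderiv q) r * poly \<Phi> r" using layer[OF that] by simp
      finally show ?thesis by simp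
    qed
    \<comment> \<open>The assumption on the layers starts at \<open>r > 0\<close>; the excluded
      point is a null set.\<close>
    moreover have "AE r in lborel. r \<noteq> (0 :: real)" by (rule AE_lborel_singleton)
    ultimately show "AE r in L. (LINT x|N. f x r) = poly (pderiv q * \<Phi>) r"
      unfolding L_def by (subst AE_restrict_space_iff) (auto elim!: eventually_mono)
  qed
  also have "\<dots> = (LINT r:{0..1}|lborel. poly (pderiv q * \<Phi>) r)"
    unfolding L_def set_lebesgue_integral_def by (rule integral_restrict_space) simp
  also have "\<dots> = integral {0..1} (poly (pderiv q * \<Phi>))"
    unfolding set_integrable_def
    by (intro set_borel_integral_eq_integral(2), unfold set_integrable_def,
        intro borel_integrable_compact continuous_intros) auto
  also have "\<dots> = poly q 1 * poly \<Phi> 1 - integral {0..1} (poly (q * pderiv \<Phi>))"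
    using integral_poly_by_parts[of 0 1 q \<Phi>] \<open>poly \<Phi> 0 = 0\<close> by simp
  finally show ?thesis using main by simp
qed

text \<open>Along the ray from z through x, g is a polynomial in r. Continuity of its coefficients
  in x is what allows them to be integrated over F one by one.\<close>

lemma poly_space_dilation:
  fixes g :: "'a::euclidean_space \<Rightarrow> real"
  assumes "g \<in> poly_space B m" "finite B"
  obtains P where "\<And>x r. g (z + r *\<^sub>R (x - z)) = poly (P x) r" "\<And>x. degree (P x) \<le> m"
    "\<And>j. continuous_on UNIV (\<lambda>x. coeff (P x) j)"
proof -
  define I where "I = {\<beta>. \<beta> \<in> B \<rightarrow>\<^sub>E (UNIV :: nat set) \<and> (\<Sum>b\<in>B. \<beta> b) \<le> m}"
  obtain c where c: "g = (\<lambda>x. \<Sum>\<beta>\<in>I. c \<beta> * (\<Prod>b\<in>B. (x \<bullet> b) ^ \<beta> b))"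
    using assms(1) unfolding poly_space_def I_def by auto
  have mult: "\<forall>j. continuous_on UNIV (\<lambda>x. coeff (f x * h x) j)"
    if "\<forall>j. continuous_on UNIV (\<lambda>x. coeff (f x) j)" "\<forall>j. continuous_on UNIV (\<lambda>x. coeff (h x) j)"
    for f h :: "'a \<Rightarrow> real poly"
    unfolding coeff_mult using that by (auto intro!: continuous_intros)
  define M where "M \<beta> x = (\<Prod>b\<in>B. [:z \<bullet> b, (x - z) \<bullet> b:] ^ \<beta> b)" for \<beta> x
  have "continuous_on UNIV (\<lambda>x. coeff ([:z \<bullet> b, (x - z) \<bullet> b:]) j)" for b j
    by (cases j; cases "j - 1") (auto intro!: continuous_intros)
  then have "\<forall>j. continuous_on UNIV (\<lambda>x. coeff ([:z \<bullet> b, (x - z) \<bullet> b:] ^ e) j)" for b e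
    by (induction e) (auto intro!: mult[rule_format] simp del: mult_pCons_left)
  then have "\<forall>j. continuous_on UNIV (\<lambda>x. coeff (\<Prod>b\<in>C. [:z \<bullet> b, (x - z) \<bullet> b:] ^ \<beta> b) j)" for C \<beta>
    by (induction C rule: infinite_finite_induct) (auto intro!: mult[rule_format])
  then have contM: "continuous_on UNIV (\<lambda>x. coeff (M \<beta> x) j)" for \<beta> j unfolding M_def by blast
  have degM: "degree (M \<beta> x) \<le> m" if "\<beta> \<in> I" for \<beta> x
  proof -
    have "degree (M \<beta> x) \<le> (\<Sum>b\<in>B. degree ([:z \<bullet> b, (x - z) \<bullet> b:] ^ \<beta> b))"
      unfolding M_def using degree_prod_sum_le[OF assms(2)] by (simp add: o_def)
    also have "\<dots> \<le> (\<Sum>b\<in>B. \<beta> b)"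
      by (intro sum_mono order.trans[OF degree_power_le]) auto
    also have "\<dots> \<le> m" using that by (simp add: I_def)
    finally show ?thesis .
  qed
  define P where "P x = (\<Sum>\<beta>\<in>I. smult (c \<beta>) (M \<beta> x))" for x
  show ?thesis
  proof
    show "g (z + r *\<^sub>R (x - z)) = poly (P x) r" for x r
      by (simp add: c P_def M_def poly_sum poly_prod inner_simps)
    show "degree (P x) \<le> m" for x
    proof (cases "finite I")
      case True
      then show ?thesis unfolding P_def
        by (intro degree_sum_le order.trans[OF degree_smult_le] degM) auto
    qed (simp add: P_def)
    show "continuous_on UNIV (\<lambda>x. coeff (P x) j)" for j
      unfolding P_def coeff_sum by (auto intro!: continuous_intros contM)
  qed
qed

text \<open>The layers \<open>{x \<in> F. s x \<le> r}\<close> are the images of F under the dilations centred at z.\<close>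

lemma facet_orthogonality:
  fixes F :: "'a::euclidean_space set" and s g :: "'a \<Rightarrow> real"
  assumes F: "compact F" "z \<in> F" and n: "card (tangent_basis F) = Suc n"
    and s: "continuous_on UNIV s" "\<And>x. x \<in> F \<Longrightarrow> s x \<in> {0..1}"
    and layer: "\<And>x r. 0 < r \<Longrightarrow> r \<le> 1 \<Longrightarrow>
      z + r *\<^sub>R (x - z) \<in> F \<and> s (z + r *\<^sub>R (x - z)) \<le> r \<longleftrightarrow> x \<in> F"
    and g: "g \<in> poly_on_face m F"
    and p: "\<And>q. degree q \<le> m \<Longrightarrow>
      integral {-1..1} (\<lambda>x. poly p x * poly q x * ((1 - x) ^ 0 * (1 + x) ^ n)) = 0"
  shows "(LINT x:F|flat_measure F. g x * poly p (2 * s x - 1)) = 0"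
proof -
  have "g \<in> poly_space (tangent_basis F) m" using g by (simp add: poly_on_face_def)
  then obtain P where P: "\<And>x r. g (z + r *\<^sub>R (x - z)) = poly (P x) r" "\<And>x. degree (P x) \<le> m"
    "\<And>j. continuous_on UNIV (\<lambda>x. coeff (P x) j)"
    using poly_space_dilation[OF _ tangent_basis_properties(4)] by metis
  have g_P: "g x = (\<Sum>j\<le>m. coeff (P x) j)" for x
  proof -
    have "g x = poly (P x) 1" using P(1)[of 1 x] by simp
    also have "\<dots> = (\<Sum>j\<le>m. coeff (P x) j)"
      using P(2)[of x]
      by (auto simp: poly_altdef intro!: sum.mono_neutral_left le_degree)
    finally show ?thesis .
  qed
  have g_cont: "continuous_on UNIV g" unfolding g_P by (intro continuous_intros P(3))
  define c where "c j = (LINT x:F|flat_measure F. coeff (P x) j)" for j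
  define Q where "Q = (\<Sum>j\<le>m. monom (c j) j)"
  \<comment> \<open>Pulling the layer at r back to F gives the volume factor
    \<open>r ^ Suc n\<close>; expanding g along the rays and integrating the coefficients gives
    Q.\<close>
  define \<Phi> where "\<Phi> = monom 1 (Suc n) * Q"
  have layer_integral: "(LINT x:F|flat_measure F. indicator {x. s x \<le> r} x * g x) = poly \<Phi> r"
    if r: "0 < r" "r \<le> 1" for r
  proof -
    let ?h = "\<lambda>x. indicator F x * (indicator {x. s x \<le> r} x * g x)"
    have [measurable]: "s \<in> borel_measurable borel" "g \<in> borel_measurable borel" "F \<in> sets borel"
      using s g_cont F by (auto intro: borel_measurable_continuous_onI borel_closed compact_imp_closed)
    have "(LINT x|flat_measure F. ?h x) =
        r ^ Suc n * (LINT x|flat_measure F. ?h (z + r *\<^sub>R (x - z)))"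
      unfolding n[symmetric] by (intro integral_flat_measure_dilation F r) measurable
    also have "(\<lambda>x. ?h (z + r *\<^sub>R (x - z))) = (\<lambda>x. indicator F x * g (z + r *\<^sub>R (x - z)))"
      using layer[OF r] by (auto simp: indicator_def fun_eq_iff)
    also have "(LINT x|flat_measure F. indicator F x * g (z + r *\<^sub>R (x - z))) =
        (LINT x:F|flat_measure F. \<Sum>j\<le>m. r ^ j * coeff (P x) j)"
      unfolding set_lebesgue_integral_def P(1) using P(2)
      by (intro Bochner_Integration.integral_cong)
         (auto simp: poly_altdef mult.commute intro!: arg_cong2[where f = "(*)"] sum.mono_neutral_left le_degree)
    also have "\<dots> = (\<Sum>j\<le>m. r ^ j * c j)"
    proof -
      have "set_integrable (flat_measure F) F (\<lambda>x. r ^ j * coeff (P x) j)" for j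
        by (intro set_integrable_flat_measure F continuous_intros
            continuous_on_subset[OF P(3)]) auto
      then have "(LINT x:F|flat_measure F. \<Sum>j\<le>m. r ^ j * coeff (P x) j) =
          (\<Sum>j\<le>m. LINT x:F|flat_measure F. r ^ j * coeff (P x) j)"
        unfolding set_lebesgue_integral_def set_integrable_def scaleR_sum_right
        by (intro Bochner_Integration.integral_sum)
      then show ?thesis by (simp add: c_def)
    qed
    finally show ?thesis
      by (simp add: set_lebesgue_integral_def \<Phi>_def Q_def poly_monom poly_sum mult_ac)
  qed
  define p' where "p' = p \<circ>\<^sub>p [:- 1, 2:]"
  have p': "poly p' u = poly p (2 * u - 1)" for u by (simp add: p'_def poly_pcompose algebra_simps)
  have "(LINT x:F|flat_measure F. g x * poly p (2 * s x - 1)) = integral {0..1} (poly (p' * pderiv \<Phi>))"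
    using set_integral_poly_layers[OF F(1) s g_cont layer_integral, of p']
    by (simp add: p' \<Phi>_def poly_monom)
  also have "\<dots> = 0"
  proof -
    \<comment> \<open>The derivative of \<open>\<Phi>\<close> is \<open>r ^ n * Q1\<close>: the
      power becomes the Jacobi weight under \<open>x = 2 * r - 1\<close>, and Q1 is a test
      polynomial of degree at most m.\<close>
    define Q1 where "Q1 = smult (real (Suc n)) Q + [:0, 1:] * pderiv Q"
    have "degree Q \<le> m" unfolding Q_def by (intro degree_sum_le order.trans[OF degree_monom_le]) auto
    moreover have "degree ([:0, 1:] * pderiv Q) \<le> m"
    proof (cases "degree Q = 0")
      case True
      then have "pderiv Q = 0" by (simp add: pderiv_eq_0_iff)
      then show ?thesis by simp
    next
      case False
      then show ?thesis
        using degree_mult_le[of "[:0, 1:]" "pderiv Q"] \<open>degree Q \<le> m\<close>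
        by (simp add: degree_pderiv del: mult_pCons_left)
    qed
    ultimately have "degree Q1 \<le> m"
      unfolding Q1_def by (intro degree_add_le order.trans[OF degree_smult_le])
    \<comment> \<open>The inner substitution is the inverse \<open>r = (1 + x) / 2\<close>, and
      \<open>1 / 2 ^ n\<close> offsets \<open>(1 + x) ^ n = (2 * r) ^ n\<close>.\<close>
    define q where "q = smult (1 / 2 ^ n) (Q1 \<circ>\<^sub>p [:1 / 2, 1 / 2:])"
    have "degree q \<le> m" using \<open>degree Q1 \<le> m\<close> by (simp add: q_def degree_pcompose)
    then have "integral {-1..1} (\<lambda>x. poly p x * poly q x * ((1 - x) ^ 0 * (1 + x) ^ n)) = 0" by (rule p)
    moreover have "(\<lambda>x. poly p x * poly q x * ((1 - x) ^ 0 * (1 + x) ^ n)) = poly (p * q * [:1, 1:] ^ n)"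
      by auto
    ultimately have "(poly (p * q * [:1, 1:] ^ n) has_integral 0) (cbox (- 1) 1)"
      using integrable_integral[OF integrable_poly[of "p * q * [:1, 1:] ^ n" "- 1" 1]] by simp
    from has_integral_affinity'[OF this, of 2 "- 1"]
    have "((\<lambda>u. poly (p * q * [:1, 1:] ^ n) (2 * u - 1)) has_integral 0) {0..1}" by simp
    moreover have "poly (p * q * [:1, 1:] ^ n) (2 * u - 1) = poly (p' * pderiv \<Phi>) u" for u
    proof -
      have "monom (real (Suc n)) n = smult (real (Suc n)) (monom 1 n)" by (simp add: smult_monom)
      then have "pderiv \<Phi> = monom 1 n * Q1"
        unfolding \<Phi>_def Q1_def pderiv_mult pderiv_monom by (simp add: algebra_simps monom_Suc)
      then have \<Phi>: "poly (pderiv \<Phi>) u = u ^ n * poly Q1 u" by (simp add: poly_monom)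
      have "poly q (2 * u - 1) * (2 * u) ^ n = u ^ n * poly Q1 u"
        by (simp add: q_def poly_pcompose power_mult_distrib algebra_simps)
      then show ?thesis unfolding poly_mult \<Phi> p' by (simp add: mult.assoc)
    qed
    then have "(\<lambda>u. poly (p * q * [:1, 1:] ^ n) (2 * u - 1)) = poly (p' * pderiv \<Phi>)" by (rule ext)
    ultimately have "(poly (p' * pderiv \<Phi>) has_integral 0) {0..1}" by simp
    then show ?thesis by (rule integral_unique)
  qed
  finally show ?thesis .
qed

section \<open>Polynomials spanned by the hierarchical functions\<close>

text \<open>Polynomials of degree at most m in the generators G. Barycentric coordinates satisfy a
  linear relation on a face, so coefficients would not be unique; a derivation only witnesses a
  degree bound.\<close>

inductive polyfn :: "('x \<Rightarrow> real) set \<Rightarrow> nat \<Rightarrow> ('x \<Rightarrow> real) \<Rightarrow> bool" for G where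
  const: "polyfn G m (\<lambda>_. c)"
| add: "polyfn G m f \<Longrightarrow> polyfn G m g \<Longrightarrow> polyfn G m (\<lambda>x. f x + g x)"
| gen_mult: "polyfn G m f \<Longrightarrow> g \<in> G \<Longrightarrow> polyfn G (Suc m) (\<lambda>x. g x * f x)"

lemma polyfn_mono_degree: "polyfn G m f \<Longrightarrow> m \<le> n \<Longrightarrow> polyfn G n f"
proof (induction arbitrary: n rule: polyfn.induct)
  case (gen_mult m f g)
  then obtain n' where "n = Suc n'" "m \<le> n'" by (cases n) auto
  then show ?case using gen_mult by (auto intro: polyfn.gen_mult)
qed (auto intro: polyfn.intros)

lemma polyfn_gen: "g \<in> G \<Longrightarrow> polyfn G 1 g"
  using polyfn.gen_mult[OF polyfn.const[of G 0 1], of g] by simp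

lemma polyfn_mult:
  "polyfn G m f \<Longrightarrow> polyfn G n h \<Longrightarrow> polyfn G (m + n) (\<lambda>x. f x * h x)"
proof (induction arbitrary: rule: polyfn.induct)
  case (const m c)
  from const have "polyfn G n (\<lambda>x. c * h x)"
  proof (induction rule: polyfn.induct)
    case (const m c')
    show ?case by (rule polyfn.const)
  next
    case (add m f g)
    then show ?case by (simp add: distrib_left polyfn.add)
  next
    case (gen_mult m f g)
    then show ?case using polyfn.gen_mult[of G m "\<lambda>x. c * f x" g] by (simp add: mult.left_commute)
  qed
  then show ?case by (rule polyfn_mono_degree) simp
next
  case (add m f g)
  then show ?case by (simp add: distrib_right polyfn.add)
next
  case (gen_mult m f g)
  then show ?case using polyfn.gen_mult[of G "m + n" "\<lambda>x. f x * h x" g] by (simp add: mult.assoc)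
qed

lemma polyfn_cmult: "polyfn G n h \<Longrightarrow> polyfn G n (\<lambda>x. c * h x)"
  using polyfn_mult[OF polyfn.const[of G 0 c]] by auto

lemma polyfn_diff:
  "polyfn G n f \<Longrightarrow> polyfn G n h \<Longrightarrow> polyfn G n (\<lambda>x. f x - h x)"
  using polyfn.add[OF _ polyfn_cmult[of G n h "- 1"]] by auto

lemma polyfn_sum:
  "(\<And>i. i \<in> I \<Longrightarrow> polyfn G n (f i)) \<Longrightarrow> polyfn G n (\<lambda>x. \<Sum>i\<in>I. f i x)"
  by (induction I rule: infinite_finite_induct) (auto intro: polyfn.intros)

lemma polyfn_prod:
  "(\<And>i. i \<in> I \<Longrightarrow> polyfn G (d i) (f i)) \<Longrightarrow> polyfn G (\<Sum>i\<in>I. d i) (\<lambda>x. \<Prod>i\<in>I. f i x)"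
  by (induction I rule: infinite_finite_induct) (auto intro: polyfn.const polyfn_mult)

lemma polyfn_power: "polyfn G 1 f \<Longrightarrow> polyfn G n (\<lambda>x. f x ^ n)"
  using polyfn_prod[of "{..<n}" G "\<lambda>_. 1" "\<lambda>_. f"] by simp

lemma polyfn_poly: "polyfn G 1 f \<Longrightarrow> degree p \<le> n \<Longrightarrow> polyfn G n (\<lambda>x. poly p (f x))"
  unfolding poly_altdef
  by (intro polyfn_sum polyfn_cmult polyfn_mono_degree[OF polyfn_power]) auto

text \<open>Used to change generators without raising the degree, from coordinates to their partial
  sums or to Cartesian variables.\<close>

lemma polyfn_subst:
  "polyfn G m f \<Longrightarrow> (\<And>g. g \<in> G \<Longrightarrow> polyfn H 1 g) \<Longrightarrow> polyfn H m f"
proof (induction rule: polyfn.induct)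
  case (gen_mult m f g)
  then show ?case using polyfn_mult[of H 1 g m f] by simp
qed (auto intro: polyfn.intros)

lemma polyfn_mono_gens: "polyfn G m f \<Longrightarrow> G \<subseteq> H \<Longrightarrow> polyfn H m f"
  by (erule polyfn_subst) (rule polyfn_gen, blast)

lemma polyfn_homog:
  assumes "polyfn G 1 t" "polyfn G 1 s"
  shows "polyfn G n (\<lambda>x. homog n p (t x) (s x))"
proof -
  have "polyfn G (i + (n - i)) (\<lambda>x. coeff p i * (t x ^ i) * (s x ^ (n - i)))" for i
    using assms by (intro polyfn_mult polyfn_cmult polyfn_power)
  then show ?thesis unfolding homog_def
    by (intro polyfn_sum) (metis atMost_iff le_add_diff_inverse)
qed

lemma polyfn_bary_jacobi:
  assumes "\<And>i. i \<le> l \<Longrightarrow> polyfn G 1 (Y i)"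
  shows "polyfn G (\<Sum>j=1..l. \<alpha> j) (\<lambda>x. bary_jacobi l \<alpha> (\<lambda>i. Y i x))"
  unfolding bary_jacobi_def Let_def
  by (intro polyfn_prod polyfn_homog polyfn_diff polyfn.add polyfn_sum polyfn_cmult assms) auto

lemma polyfn_continuous_on:
  "polyfn G m f \<Longrightarrow> (\<And>g. g \<in> G \<Longrightarrow> continuous_on X g) \<Longrightarrow> continuous_on X f"
  by (induction rule: polyfn.induct) (auto intro: continuous_intros)

text \<open>Lets an arbitrary multiindex be replaced by its restriction, since
  \<open>index_set\<close> admits only extensional ones.\<close>

lemma bary_jacobi_cong:
  assumes "\<And>j. j \<in> {1..l} \<Longrightarrow> \<alpha> j = \<beta> j" "\<And>i. i \<le> l \<Longrightarrow> y i = z i"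
  shows "bary_jacobi l \<alpha> y = bary_jacobi l \<beta> z"
proof -
  have "(\<Sum>m=j+1..l. \<alpha> m) = (\<Sum>m=j+1..l. \<beta> m)" "(\<Sum>m=j..l. y m) = (\<Sum>m=j..l. z m)" for j
    using assms by (auto intro!: sum.cong)
  then show ?thesis
    using assms unfolding bary_jacobi_def Let_def by (intro prod.cong) auto
qed

text \<open>The first argument \<open>2 * y j - S\<close> of \<open>homog\<close> in \<open>bary_jacobi\<close> is \<open>S - 2 * t\<close> with \<open>t = S - y j\<close>.\<close>

lemma homog_leading_term:
  assumes "degree p = n" "p \<noteq> 0"
  obtains c where "c n \<noteq> 0"
    "\<And>S t. homog n p (S - 2 * t) S = (\<Sum>i\<le>n. c i * t ^ i * S ^ (n - i))"
proof -
  define q where "q = p \<circ>\<^sub>p [:1, - 2:]"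
  have q: "degree q = n" using assms by (simp add: q_def degree_pcompose)
  have lc: "coeff q n = coeff p n * (- 2) ^ n"
    using lead_coeff_comp[of "[:1, - 2:]" p] assms q by (simp add: q_def)
  \<comment> \<open>For S nonzero this is the substitution
    \<open>(S - 2 * t) / S = 1 - 2 * (t / S)\<close>. At S = 0 only the top terms survive, and they
    agree by \<open>lc\<close>.\<close>
  have "homog n p (S - 2 * t) S = (\<Sum>i\<le>n. coeff q i * t ^ i * S ^ (n - i))" for S t
  proof (cases "S = 0")
    case True
    have "(\<Sum>i\<le>n. coeff r i * u ^ i * 0 ^ (n - i)) = coeff r n * u ^ n" for r :: "real poly" and u
      by (subst sum.remove[of _ n]) (auto intro!: sum.neutral)
    then show ?thesis using True lc by (simp add: homog_def power_mult_distrib[symmetric])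
  next
    case False
    have "homog n p (S - 2 * t) S = S ^ n * poly p ((S - 2 * t) / S)"
      using assms False by (intro homog_eq) auto
    also have "(S - 2 * t) / S = 1 + (t / S) * - 2" using False by (simp add: field_simps)
    also have "poly p (1 + (t / S) * - 2) = poly q (t / S)" by (simp add: q_def poly_pcompose)
    also have "S ^ n * poly q (t / S) = homog n q t S"
      using q False by (intro homog_eq[symmetric]) auto
    finally show ?thesis by (simp add: homog_def)
  qed
  moreover have "coeff q n \<noteq> 0" using lc assms by (metis leading_coeff_0_iff mult_eq_0_iff power_not_zero zero_neq_numeral neg_equal_0_iff_equal)
  ultimately show ?thesis using that by blast
qed

text \<open>Abstracts the functions annihilated by g. Membership depends on values in X alone, so
  identities valid only there, such as coordinates adding up to 1, may be applied.\<close>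

locale linear_class =
  fixes X :: "'x set" and N :: "('x \<Rightarrow> real) \<Rightarrow> bool"
  assumes cong: "N f \<Longrightarrow> (\<And>x. x \<in> X \<Longrightarrow> f x = g x) \<Longrightarrow> N g"
    and zero: "N (\<lambda>_. 0)"
    and add: "N f \<Longrightarrow> N g \<Longrightarrow> N (\<lambda>x. f x + g x)"
    and cmult: "N f \<Longrightarrow> N (\<lambda>x. c * f x)"
begin

lemma diff: "N f \<Longrightarrow> N g \<Longrightarrow> N (\<lambda>x. f x - g x)"
  using add[OF _ cmult[of g "- 1"]] by auto

lemma sum: "(\<And>i. i \<in> I \<Longrightarrow> N (f i)) \<Longrightarrow> N (\<lambda>x. \<Sum>i\<in>I. f i x)"
  by (induction I rule: infinite_finite_induct) (auto intro: zero add)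

text \<open>With w the product of the coordinates of a face, this lets the exchange of Jacobi
  factors for monomials run behind that fixed product.\<close>

lemma weighted: "linear_class X (\<lambda>f. N (\<lambda>x. w x * f x))"
proof
  show "N (\<lambda>x. w x * g x)" if "N (\<lambda>x. w x * f x)" "\<And>x. x \<in> X \<Longrightarrow> f x = g x" for f g
    using that by (auto intro: cong[of "\<lambda>x. w x * f x"])
  show "N (\<lambda>x. w x * (f x + g x))" if "N (\<lambda>x. w x * f x)" "N (\<lambda>x. w x * g x)" for f g
    using add[OF that] by (simp add: distrib_left)
  show "N (\<lambda>x. w x * (c * f x))" if "N (\<lambda>x. w x * f x)" for f c
    using cmult[OF that, of c] by (simp add: mult.left_commute)
qed (simp add: zero)

text \<open>The induction on the derivation carries a monomial as an accumulator; every
  multiplication by a generator raises one of its exponents.\<close>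

lemma polyfn_if_monomials:
  assumes f: "polyfn (t ` I) m f" and "finite I"
    and mono: "\<And>\<gamma>. (\<Sum>i\<in>I. \<gamma> i) \<le> M \<Longrightarrow> N (\<lambda>x. \<Prod>i\<in>I. t i x ^ \<gamma> i)"
    and "m \<le> M"
  shows "N f"
proof -
  have "N (\<lambda>x. (\<Prod>i\<in>I. t i x ^ \<gamma> i) * f x)" if "(\<Sum>i\<in>I. \<gamma> i) + m \<le> M" for \<gamma>
    using f that
  proof (induction arbitrary: \<gamma> rule: polyfn.induct)
    case (const m c)
    then show ?case using cmult[OF mono[of \<gamma>], of c] by (simp add: mult.commute)
  next
    case (add m f g)
    then show ?case using linear_class.add[OF linear_class_axioms] by (simp add: distrib_left)
  next
    case (gen_mult m f g)
    then obtain j where j: "j \<in> I" "g = t j" by auto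
    have "(\<Sum>i\<in>I. (\<gamma>(j := Suc (\<gamma> j))) i) = Suc (\<Sum>i\<in>I. \<gamma> i)"
      using j \<open>finite I\<close> by (simp add: sum.remove[of I j])
    then have "N (\<lambda>x. (\<Prod>i\<in>I. t i x ^ (\<gamma>(j := Suc (\<gamma> j))) i) * f x)"
      using gen_mult.prems by (intro gen_mult.IH) auto
    then show ?case
      using j \<open>finite I\<close> by (simp add: prod.remove[of I j] mult_ac)
  qed
  from this[of "\<lambda>_. 0"] show ?thesis using \<open>m \<le> M\<close> by simp
qed

text \<open>The j-th factor of \<open>bary_jacobi\<close> is, up to a nonzero constant, \<open>t j ^ \<alpha> j\<close> plus multiples of
  \<open>t j ^ i * t (j - 1) ^ (\<alpha> j - i)\<close> with \<open>i < \<alpha> j\<close>. So the factors can be replaced by powers of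
  \<open>t j\<close> one after the other, and powers of \<open>t 0\<close> are harmless because \<open>t 0\<close> is 1 modulo N.\<close>

lemma polyfn_if_bary_jacobi:
  fixes Y :: "nat \<Rightarrow> 'x \<Rightarrow> real"
    and l M :: nat
  defines "t \<equiv> \<lambda>j x. Y 0 x + (\<Sum>m=Suc j..l. Y m x)"
  assumes base: "\<And>\<alpha>. (\<Sum>j=1..l. \<alpha> j) \<le> M \<Longrightarrow> N (\<lambda>x. bary_jacobi l \<alpha> (\<lambda>i. Y i x))"
    and unit: "\<And>r m. polyfn (Y ` {0..l}) m r \<Longrightarrow> Suc m \<le> M \<Longrightarrow> N (\<lambda>x. (1 - t 0 x) * r x)"
    and f: "polyfn (Y ` {0..l}) M f"
  shows "N f"
proof -
  define F where "F \<alpha> j x = homog (\<alpha> j)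
      (jacobi (2 * (\<Sum>m=j+1..l. \<alpha> m) + 2 * (l - j) + 1) 1 (\<alpha> j))
      (2 * Y j x - t (j - 1) x) (t (j - 1) x)" for \<alpha> :: "nat \<Rightarrow> nat" and j x
  have bary_F: "bary_jacobi l \<alpha> (\<lambda>i. Y i x) = (\<Prod>j=1..l. F \<alpha> j x)" for \<alpha> x
    unfolding bary_jacobi_def F_def Let_def t_def by (intro prod.cong) auto
  have Y_t: "Y j x = t (j - 1) x - t j x" if "1 \<le> j" "j \<le> l" for j x
    using that unfolding t_def by (simp add: sum.atLeast_Suc_atMost[of j])
  have t_poly: "polyfn (Y ` {0..l}) 1 (t j)" for j
    unfolding t_def by (intro polyfn.add polyfn_sum polyfn_gen) auto
  \<comment> \<open>Interpolates between all Jacobi factors at \<open>j = 1\<close> and pure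
    monomials at \<open>j = Suc l\<close>. The degree bound counts the exponent of
    \<open>t 0\<close> too, because the exchange moves exponents down to it.\<close>
  have claim: "N (\<lambda>x. (\<Prod>m<j. t m x ^ \<alpha> m) * (\<Prod>m=j..l. F \<alpha> m x))"
    if "1 \<le> j" "j \<le> Suc l" "(\<Sum>m\<le>l. \<alpha> m) \<le> M" for j \<alpha>
    using that
  proof (induction j arbitrary: \<alpha> rule: dec_induct)
    case base
    define P where "P = (\<lambda>x. \<Prod>j=1..l. F \<alpha> j x)"
    have deg: "\<alpha> 0 + (\<Sum>j=1..l. \<alpha> j) \<le> M"
      using base by (simp add: atMost_atLeast0 sum.atLeast_Suc_atMost)
    have P: "polyfn (Y ` {0..l}) (\<Sum>j=1..l. \<alpha> j) P"
      unfolding P_def bary_F[symmetric] by (intro polyfn_bary_jacobi polyfn_gen) auto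
    have NP: "N P" unfolding P_def bary_F[symmetric] using deg by (intro assms(2)) auto
    \<comment> \<open>By the geometric sum,
      \<open>t 0 ^ a = 1 - (1 - t 0) * (\<Sum>i<a. t 0 ^ i)\<close>; the subtracted part is covered
      by \<open>unit\<close>.\<close>
    have "N (\<lambda>x. t 0 x ^ \<alpha> 0 * P x)"
    proof (cases "\<alpha> 0")
      case 0
      then show ?thesis using NP by simp
    next
      case (Suc e)
      have "polyfn (Y ` {0..l}) (e + (\<Sum>j=1..l. \<alpha> j)) (\<lambda>x. (\<Sum>i<\<alpha> 0. t 0 x ^ i) * P x)"
        using Suc t_poly
        by (intro polyfn_mult P polyfn_sum polyfn_mono_degree[OF polyfn_power]) auto
      then have "N (\<lambda>x. (1 - t 0 x) * ((\<Sum>i<\<alpha> 0. t 0 x ^ i) * P x))"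
        using deg Suc by (intro unit) auto
      from diff[OF NP this] show ?thesis
        unfolding mult.assoc[symmetric] one_diff_power_eq[symmetric]
        by (rule cong) (simp add: left_diff_distrib)
    qed
    then show ?case by (simp add: P_def)
  next
    case (step j)
    \<comment> \<open>The lower terms of the j-th factor have the required form with a smaller
      exponent at j, hence an inner induction on that exponent.\<close>
    from step.prems show ?case
    proof (induction "\<alpha> j" arbitrary: \<alpha> rule: less_induct)
      case less
      define n where "n = \<alpha> j"
      define s where "s = 2 * (\<Sum>m=j+1..l. \<alpha> m) + 2 * (l - j) + 1"
      define R where "R x = (\<Prod>m<j. t m x ^ \<alpha> m) * (\<Prod>m=Suc j..l. F \<alpha> m x)" for x
      have "poly (jacobi s 1 n) 1 \<noteq> 0"
        using pochhammer_pos[of "real s + 1" n] by (simp add: poly_jacobi_1)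
      then have "jacobi s 1 n \<noteq> 0" by auto
      then obtain c where c: "c n \<noteq> 0" "\<And>S t. homog n (jacobi s 1 n) (S - 2 * t) S =
          (\<Sum>i\<le>n. c i * t ^ i * S ^ (n - i))"
        using homog_leading_term[OF degree_jacobi] by metis
      have "2 * Y j x - t (j - 1) x = t (j - 1) x - 2 * t j x" for x
        using Y_t[of j x] step by simp
      then have F: "F \<alpha> j x = (\<Sum>i\<le>n. c i * t j x ^ i * t (j - 1) x ^ (n - i))" for x
        unfolding F_def n_def[symmetric] s_def[symmetric] by (simp only: c(2))
      have lower: "N (\<lambda>x. c i * (R x * t j x ^ i * t (j - 1) x ^ (n - i)))" if "i < n" for i
      proof -
        \<comment> \<open>Moves \<open>n - i\<close> from the exponent at j to the one at
          \<open>j - 1\<close>, so the total is kept. The factors beyond j depend only on exponents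
          beyond j and do not change.\<close>
        define \<beta> where "\<beta> = \<alpha>(j := i, j - 1 := \<alpha> (j - 1) + (n - i))"
        have j: "j - 1 \<noteq> j" "j - 1 < j" using step by auto
        have "(\<Sum>m\<le>l. \<beta> m) = \<beta> j + (\<beta> (j - 1) + (\<Sum>m\<in>{..l} - {j} - {j - 1}. \<beta> m))"
          using j step by (simp add: sum.remove[of _ j] sum.remove[of _ "j - 1"])
        also have "(\<Sum>m\<in>{..l} - {j} - {j - 1}. \<beta> m) = (\<Sum>m\<in>{..l} - {j} - {j - 1}. \<alpha> m)"
          by (intro sum.cong) (auto simp: \<beta>_def)
        also have "\<beta> j + (\<beta> (j - 1) + \<dots>) = \<alpha> j + (\<alpha> (j - 1) + \<dots>)"
          using that j by (simp add: \<beta>_def n_def)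
        also have "\<dots> = (\<Sum>m\<le>l. \<alpha> m)"
          using j step by (simp add: sum.remove[of _ j] sum.remove[of _ "j - 1"])
        finally have deg: "(\<Sum>m\<le>l. \<beta> m) \<le> M" using less.prems by simp
        have F_eq: "F \<beta> m x = F \<alpha> m x" if "m \<in> {Suc j..l}" for m x
        proof -
          have "\<beta> i = \<alpha> i" if "i \<ge> m" for i
            using that \<open>m \<in> {Suc j..l}\<close> by (auto simp: \<beta>_def)
          moreover from this have "(\<Sum>i=m+1..l. \<beta> i) = (\<Sum>i=m+1..l. \<alpha> i)"
            by (intro sum.cong) auto
          ultimately show ?thesis unfolding F_def by simp
        qed
        have pr: "(\<Prod>m<Suc j. t m x ^ \<beta> m) =
            (\<Prod>m<j. t m x ^ \<alpha> m) * t j x ^ i * t (j - 1) x ^ (n - i)" for x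
        proof -
          obtain j' where j': "j = Suc j'" using step by (cases j) auto
          have "(\<Prod>m<j'. t m x ^ \<beta> m) = (\<Prod>m<j'. t m x ^ \<alpha> m)"
            by (intro prod.cong) (auto simp: \<beta>_def j')
          then show ?thesis by (simp add: j' \<beta>_def power_add mult_ac)
        qed
        have "N (\<lambda>x. (\<Prod>m<Suc j. t m x ^ \<beta> m) * (\<Prod>m=Suc j..l. F \<beta> m x))"
          using that deg less.prems j by (intro less.hyps) (auto simp: \<beta>_def n_def)
        then have "N (\<lambda>x. c i * ((\<Prod>m<Suc j. t m x ^ \<beta> m) * (\<Prod>m=Suc j..l. F \<beta> m x)))"
          by (rule cmult)
        moreover have "(\<Prod>m=Suc j..l. F \<beta> m x) = (\<Prod>m=Suc j..l. F \<alpha> m x)" for x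
          by (intro prod.cong refl F_eq)
        ultimately show ?thesis
          unfolding pr R_def by (elim cong) (simp only: mult_ac)
      qed
      have "N (\<lambda>x. (\<Prod>m<j. t m x ^ \<alpha> m) * (\<Prod>m=j..l. F \<alpha> m x))"
        using less.prems by (intro step.IH) auto
      then have "N (\<lambda>x. R x * F \<alpha> j x)"
        using step by (elim cong) (auto simp: R_def prod.atLeast_Suc_atMost mult_ac)
      from diff[OF this sum[of "{..<n}", OF lower]]
      have "N (\<lambda>x. R x * F \<alpha> j x - (\<Sum>i<n. c i * (R x * t j x ^ i * t (j - 1) x ^ (n - i))))"
        by simp
      then have "N (\<lambda>x. c n * (R x * t j x ^ n))"
        by (rule cong) (simp add: F distrib_left sum_distrib_left lessThan_Suc_atMost[symmetric] mult_ac)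
      from cmult[OF this, of "1 / c n"] have "N (\<lambda>x. R x * t j x ^ n)"
        by (rule cong) (simp add: c)
      then show ?case
        by (rule cong) (simp add: R_def n_def mult_ac)
    qed
  qed
  have "polyfn (t ` {..l}) 1 (Y j)" if "j \<le> l" for j
  proof (cases "j = 0")
    case True
    have "Y 0 = t l" by (simp add: t_def)
    then show ?thesis using True by (intro polyfn_gen) auto
  next
    case False
    then have "Y j = (\<lambda>x. t (j - 1) x - t j x)" using that Y_t[of j] by auto
    moreover have "polyfn (t ` {..l}) 1 (\<lambda>x. t (j - 1) x - t j x)"
      using that by (intro polyfn_diff polyfn_gen) auto
    ultimately show ?thesis by simp
  qed
  then have "polyfn (t ` {..l}) M f" by (intro polyfn_subst[OF f]) auto
  moreover have "N (\<lambda>x. \<Prod>m\<in>{..l}. t m x ^ \<gamma> m)" if "(\<Sum>m\<in>{..l}. \<gamma> m) \<le> M" for \<gamma>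
    using claim[of "Suc l" \<gamma>] that unfolding lessThan_Suc_atMost by simp
  ultimately show ?thesis by (rule polyfn_if_monomials[OF _ finite_atMost _ order_refl])
qed

end

text \<open>To be instantiated with X a facet, V its vertices and y the coordinates; faces are
  represented by their vertex sets. \<open>base\<close> says that the conforming functions of all
  subfaces of positive dimension are annihilated.\<close>

locale face_functions = linear_class X N
  for X :: "'x set" and N +
  fixes V :: "'v set" and y :: "'v \<Rightarrow> 'x \<Rightarrow> real" and A :: "'v set \<Rightarrow> nat \<Rightarrow> 'v" and k :: nat
  assumes fin: "finite V"
    and sum_one: "x \<in> X \<Longrightarrow> (\<Sum>v\<in>V. y v x) = 1"
    and numbering: "\<tau> \<subseteq> V \<Longrightarrow> card \<tau> = Suc l \<Longrightarrow> 1 \<le> l \<Longrightarrow> bij_betw (A \<tau>) {0..l} \<tau>"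
    and base: "\<tau> \<subseteq> V \<Longrightarrow> card \<tau> = Suc l \<Longrightarrow> 1 \<le> l \<Longrightarrow> Suc l \<le> k \<Longrightarrow>
      (\<Sum>j=1..l. \<alpha> j) \<le> k - Suc l \<Longrightarrow>
      N (\<lambda>x. (\<Prod>v\<in>\<tau>. y v x) * bary_jacobi l \<alpha> (\<lambda>i. y (A \<tau> i) x))"
begin

text \<open>Downward induction on the dimension of \<open>\<tau>\<close>: on X the sum of the coordinates belonging to
  \<open>\<tau>\<close> differs from 1 by coordinates of further vertices, which lead to larger faces.\<close>

lemma face_polyfn:
  assumes "\<tau> \<subseteq> V" "2 \<le> card \<tau>" "card \<tau> \<le> k" "polyfn (y ` \<tau>) (k - card \<tau>) f"
  shows "N (\<lambda>x. (\<Prod>v\<in>\<tau>. y v x) * f x)"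
  using assms
proof (induction "card V - card \<tau>" arbitrary: \<tau> f rule: less_induct)
  case less
  obtain l where l: "card \<tau> = Suc l" "1 \<le> l" using less.prems by (cases "card \<tau>") auto
  have bij: "bij_betw (A \<tau>) {0..l} \<tau>" using numbering less.prems l by auto
  have finite: "finite \<tau>" using less.prems fin finite_subset by blast
  interpret W: linear_class X "\<lambda>f. N (\<lambda>x. (\<Prod>v\<in>\<tau>. y v x) * f x)" by (rule weighted)
  define Y where "Y i = y (A \<tau> i)" for i
  have Y: "Y ` {0..l} = y ` \<tau>" using bij by (force simp: Y_def bij_betw_def)
  show ?case
  proof (rule W.polyfn_if_bary_jacobi[where Y = Y and l = l and M = "k - card \<tau>"])
    show "N (\<lambda>x. (\<Prod>v\<in>\<tau>. y v x) * bary_jacobi l \<alpha> (\<lambda>i. Y i x))"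
      if "(\<Sum>j=1..l. \<alpha> j) \<le> k - card \<tau>" for \<alpha>
      unfolding Y_def using that less.prems l by (intro base) auto
    show "N (\<lambda>x. (\<Prod>v\<in>\<tau>. y v x) * ((1 - (Y 0 x + (\<Sum>m=Suc 0..l. Y m x))) * r x))"
      if r: "polyfn (Y ` {0..l}) m r" and m: "Suc m \<le> k - card \<tau>" for r m
    proof -
      \<comment> \<open>One more vertex costs one degree, which is exactly the degree that
        \<open>Suc m\<close> reserves.\<close>
      have "N (\<lambda>x. (\<Prod>v\<in>insert u \<tau>. y v x) * r x)" if u: "u \<in> V - \<tau>" for u
      proof (rule less.hyps)
        have "card (insert u \<tau>) \<le> card V" using u less.prems fin by (intro card_mono) auto
        then show "card V - card (insert u \<tau>) < card V - card \<tau>" using u finite by simp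
        show "polyfn (y ` insert u \<tau>) (k - card (insert u \<tau>)) r"
          using m u finite
          by (intro polyfn_mono_gens[OF polyfn_mono_degree[OF r[unfolded Y]]]) auto
      qed (use u m finite less.prems in auto)
      then have "N (\<lambda>x. \<Sum>u\<in>V - \<tau>. (\<Prod>v\<in>insert u \<tau>. y v x) * r x)" by (rule sum)
      then show ?thesis
      proof (rule cong)
        fix x assume "x \<in> X"
        have "Y 0 x + (\<Sum>m=Suc 0..l. Y m x) = (\<Sum>i=0..l. Y i x)"
          by (simp add: sum.atLeast_Suc_atMost)
        also have "\<dots> = (\<Sum>v\<in>\<tau>. y v x)"
          unfolding Y_def by (rule sum.reindex_bij_betw[OF bij])
        also have "\<dots> = 1 - (\<Sum>u\<in>V - \<tau>. y u x)"
          using sum_one[OF \<open>x \<in> X\<close>] sum.subset_diff[OF \<open>\<tau> \<subseteq> V\<close> fin, of "\<lambda>v. y v x"] by simp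
        finally show "(\<Sum>u\<in>V - \<tau>. (\<Prod>v\<in>insert u \<tau>. y v x) * r x) =
            (\<Prod>v\<in>\<tau>. y v x) * ((1 - (Y 0 x + (\<Sum>m=Suc 0..l. Y m x))) * r x)"
          using finite by (simp add: sum_distrib_right sum_distrib_left mult_ac)
      qed
    qed
    show "polyfn (Y ` {0..l}) (k - card \<tau>) f" using less.prems unfolding Y by simp
  qed
qed

text \<open>The difference of q and its affine interpolant at 0 and 1 is divisible by \<open>y * (1 - y)\<close>, where
  \<open>1 - y v\<close> is the sum of the other coordinates.\<close>

lemma sum_poly_coordinates:
  assumes "degree q \<le> k" "2 \<le> k"
  shows "N (\<lambda>x. (\<Sum>v\<in>V. poly q (y v x)) - ((real (card V) - 1) * poly q 0 + poly q 1))"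
proof -
  define h where "h = q - [:poly q 0, poly q 1 - poly q 0:]"
  have "poly h 0 = 0" by (simp add: h_def)
  then obtain h1 where h1: "h = [:0, 1:] * h1" using poly_eq_0_iff_dvd[of h 0] by (auto elim: dvdE)
  have "poly h 1 = 0" by (simp add: h_def)
  then have "poly h1 1 = 0" unfolding h1 by simp
  then obtain r where r: "h1 = [:- 1, 1:] * r" using poly_eq_0_iff_dvd[of h1 1] by (auto elim: dvdE)
  have "degree h \<le> k" unfolding h_def using assms by (intro degree_diff_le) auto
  then have deg: "degree r \<le> k - 2"
    by (cases "r = 0") (auto simp: h1 r degree_mult_eq simp del: mult_pCons_left)
  have q: "poly q s = poly q 0 + (poly q 1 - poly q 0) * s - s * (1 - s) * poly r s" for s
  proof -
    have "poly h s = s * (s - 1) * poly r s" unfolding h1 r by (simp add: algebra_simps)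
    moreover have "poly h s = poly q s - (poly q 0 + (poly q 1 - poly q 0) * s)"
      by (simp add: h_def mult.commute)
    ultimately show ?thesis by (simp add: algebra_simps)
  qed
  have "N (\<lambda>x. (\<Prod>u\<in>{v, w}. y u x) * poly r (y v x))" if "v \<in> V" "w \<in> V - {v}" for v w
    using that assms deg
    by (intro face_polyfn polyfn_poly polyfn_gen) (auto simp: card_insert_if)
  then have "N (\<lambda>x. \<Sum>v\<in>V. \<Sum>w\<in>V - {v}. (\<Prod>u\<in>{v, w}. y u x) * poly r (y v x))"
    by (intro sum) auto
  from cmult[OF this, of "- 1"] show ?thesis
  proof (rule cong)
    fix x assume x: "x \<in> X"
    have "(\<Sum>w\<in>V - {v}. (\<Prod>u\<in>{v, w}. y u x) * poly r (y v x)) =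
        poly q 0 + (poly q 1 - poly q 0) * y v x - poly q (y v x)" if v: "v \<in> V" for v
    proof -
      have "(\<Sum>w\<in>V - {v}. (\<Prod>u\<in>{v, w}. y u x) * poly r (y v x)) =
          (\<Sum>w\<in>V - {v}. y v x * y w x * poly r (y v x))"
        by (intro sum.cong) auto
      also have "\<dots> = y v x * (\<Sum>w\<in>V - {v}. y w x) * poly r (y v x)"
        by (simp add: sum_distrib_left sum_distrib_right)
      also have "(\<Sum>w\<in>V - {v}. y w x) = 1 - y v x"
        using sum_one[OF x] sum.remove[OF fin v, of "\<lambda>v. y v x"] by simp
      finally show ?thesis using q[of "y v x"] by simp
    qed
    then have "(\<Sum>v\<in>V. \<Sum>w\<in>V - {v}. (\<Prod>u\<in>{v, w}. y u x) * poly r (y v x)) =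
        (\<Sum>v\<in>V. poly q 0 + (poly q 1 - poly q 0) * y v x - poly q (y v x))"
      by (intro sum.cong) auto
    \<comment> \<open>The affine interpolants add up to a constant because the coordinates sum to
      1.\<close>
    also have "\<dots> = real (card V) * poly q 0 + (poly q 1 - poly q 0) - (\<Sum>v\<in>V. poly q (y v x))"
      using sum_one[OF x] by (simp add: sum.distrib sum_subtractf sum_distrib_left[symmetric])
    finally show "- 1 * (\<Sum>v\<in>V. \<Sum>w\<in>V - {v}. (\<Prod>u\<in>{v, w}. y u x) * poly r (y v x)) =
        (\<Sum>v\<in>V. poly q (y v x)) - ((real (card V) - 1) * poly q 0 + poly q 1)"
      by (simp add: algebra_simps)
  qed
qed

end

section \<open>Barycentric coordinates\<close>

lemma verts_convex_hull: "\<not> affine_dependent C \<Longrightarrow> verts (convex hull C) = C"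
  by (auto simp: verts_def extreme_point_of_convex_hull_affine_independent)

lemma simplex_verts:
  assumes "n simplex K"
  shows "\<not> affine_dependent (verts K)" "int (card (verts K)) = n + 1" "K = convex hull (verts K)"
    "finite (verts K)"
proof -
  obtain C where C: "\<not> affine_dependent C" "int (card C) = n + 1" "K = convex hull C"
    using assms unfolding simplex_def by blast
  then have "verts K = C" by (simp add: verts_convex_hull)
  then show "\<not> affine_dependent (verts K)" "int (card (verts K)) = n + 1" "K = convex hull (verts K)"
    "finite (verts K)"
    using C by (auto simp: aff_independent_finite)
qed

lemma affine_independent_coordinates_unique:
  fixes V :: "'a::euclidean_space set"
  assumes "\<not> affine_dependent V" "(\<Sum>v\<in>V. c v) = 1" "(\<Sum>v\<in>V. c' v) = 1"
    "(\<Sum>v\<in>V. c v *\<^sub>R v) = (\<Sum>v\<in>V. c' v *\<^sub>R v)" "v \<in> V"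
  shows "c v = c' v"
proof (rule ccontr)
  assume "c v \<noteq> c' v"
  moreover have "(\<Sum>v\<in>V. c v - c' v) = 0" "(\<Sum>v\<in>V. (c v - c' v) *\<^sub>R v) = 0"
    using assms by (auto simp: sum_subtractf scaleR_diff_left)
  ultimately have "affine_dependent V"
    using assms(5) aff_independent_finite[OF assms(1)]
    by (subst affine_dependent_explicit_finite) (auto intro!: exI[of _ "\<lambda>v. c v - c' v"])
  with assms(1) show False by contradiction
qed

lemma bary_eqI:
  assumes ind: "\<not> affine_dependent (verts \<tau>)" and c: "\<And>v. v \<notin> verts \<tau> \<Longrightarrow> c v = 0"
    "(\<Sum>v\<in>verts \<tau>. c v) = 1" "(\<Sum>v\<in>verts \<tau>. c v *\<^sub>R v) = x"
  shows "bary \<tau> v x = c v"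
proof -
  have "bary_coords \<tau> x = c" unfolding bary_coords_def
  proof (rule the_equality)
    fix c' assume c': "(\<forall>v. v \<notin> verts \<tau> \<longrightarrow> c' v = 0) \<and> (\<Sum>v\<in>verts \<tau>. c' v) = 1 \<and>
      (\<Sum>v\<in>verts \<tau>. c' v *\<^sub>R v) = x"
    show "c' = c"
    proof
      show "c' v = c v" for v
        using c c' affine_independent_coordinates_unique[OF ind, of c' c v] by (cases "v \<in> verts \<tau>") auto
    qed
  qed (use c in auto)
  then show ?thesis by (simp add: bary_def)
qed

locale full_simplex =
  fixes K :: "'a::euclidean_space set"
  assumes simplex: "int DIM('a) simplex K"
begin

lemmas independent = simplex_verts(1)[OF simplex]
lemmas hull = simplex_verts(3)[OF simplex]
lemmas finite_verts = simplex_verts(4)[OF simplex]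

lemma card_verts: "card (verts K) = Suc DIM('a)"
  using simplex_verts(2)[OF simplex] by linarith

lemma bary_coordinates:
  shows bary_outside: "v \<notin> verts K \<Longrightarrow> bary K v x = 0"
    and sum_bary: "(\<Sum>v\<in>verts K. bary K v x) = 1"
    and sum_bary_scaleR: "(\<Sum>v\<in>verts K. bary K v x *\<^sub>R v) = x"
proof -
  have "x \<in> affine hull (verts K)"
    using affine_independent_span_eq[OF independent] card_verts by simp
  then obtain u where u: "(\<Sum>v\<in>verts K. u v) = 1" "(\<Sum>v\<in>verts K. u v *\<^sub>R v) = x"
    using affine_hull_finite[OF finite_verts] by auto
  define c where "c v = (if v \<in> verts K then u v else 0)" for v
  have "(\<Sum>v\<in>verts K. c v) = 1" "(\<Sum>v\<in>verts K. c v *\<^sub>R v) = x"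
    using u by (auto simp: c_def cong: sum.cong)
  then have "bary K v x = c v" for v by (intro bary_eqI independent) (auto simp: c_def)
  then show "v \<notin> verts K \<Longrightarrow> bary K v x = 0" "(\<Sum>v\<in>verts K. bary K v x) = 1"
    "(\<Sum>v\<in>verts K. bary K v x *\<^sub>R v) = x"
    using u by (auto simp: c_def cong: sum.cong)
qed

lemma bary_unique:
  assumes "v \<in> verts K" "(\<Sum>v\<in>verts K. c v) = 1" "(\<Sum>v\<in>verts K. c v *\<^sub>R v) = x"
  shows "bary K v x = c v"
  using affine_independent_coordinates_unique[OF independent sum_bary[of x] assms(2) _ assms(1)]
  unfolding sum_bary_scaleR assms(3) by simp

lemma bary_vertex: "v \<in> verts K \<Longrightarrow> w \<in> verts K \<Longrightarrow> bary K v w = (if v = w then 1 else 0)"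
proof -
  assume "v \<in> verts K" "w \<in> verts K"
  moreover from this have "(\<Sum>v\<in>verts K. if v = w then 1 else 0 :: real) = 1"
    "(\<Sum>v\<in>verts K. (if v = w then 1 else 0 :: real) *\<^sub>R v) = w"
    using finite_verts by (auto simp: if_distrib[of "\<lambda>c. c *\<^sub>R _"] cong: if_cong)
  ultimately show ?thesis by (intro bary_unique) auto
qed

text \<open>The right-hand sides sum to 1 over the vertices and reproduce x, so uniqueness of
  coordinates applies. Dilation, continuity and the degree bound are read off this formula.\<close>

lemma bary_affine: "bary K v x = bary K v 0 + (\<Sum>b\<in>Basis. (x \<bullet> b) * (bary K v b - bary K v 0))"
proof (cases "v \<in> verts K")
  case True
  define c where "c v = bary K v 0 + (\<Sum>b\<in>Basis. (x \<bullet> b) * (bary K v b - bary K v 0))" for v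
  have "(\<Sum>v\<in>verts K. c v) =
      (\<Sum>v\<in>verts K. bary K v 0) + (\<Sum>b\<in>Basis. (x \<bullet> b) * (\<Sum>v\<in>verts K. bary K v b - bary K v 0))"
    unfolding c_def sum.distrib sum_distrib_left by (subst (2) sum.swap) simp
  then have "(\<Sum>v\<in>verts K. c v) = 1" by (simp add: sum_bary sum_subtractf)
  moreover have "(\<Sum>v\<in>verts K. c v *\<^sub>R v) = x"
  proof -
    have "(\<Sum>v\<in>verts K. c v *\<^sub>R v) = (\<Sum>v\<in>verts K. bary K v 0 *\<^sub>R v +
        (\<Sum>b\<in>Basis. (x \<bullet> b) *\<^sub>R (bary K v b *\<^sub>R v - bary K v 0 *\<^sub>R v)))"
      by (intro sum.cong refl)
         (simp add: c_def scaleR_add_left scaleR_sum_left scaleR_diff_left[symmetric])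
    also have "\<dots> = (\<Sum>v\<in>verts K. bary K v 0 *\<^sub>R v) +
        (\<Sum>b\<in>Basis. (x \<bullet> b) *\<^sub>R (\<Sum>v\<in>verts K. bary K v b *\<^sub>R v - bary K v 0 *\<^sub>R v))"
      unfolding sum.distrib scaleR_sum_right by (intro arg_cong2[where f = "(+)"] refl sum.swap)
    also have "\<dots> = x"
      by (simp add: sum_bary_scaleR sum_subtractf euclidean_representation)
    finally show ?thesis .
  qed
  ultimately show ?thesis using bary_unique[OF True, of c x] by (simp add: c_def)
qed (simp add: bary_outside)

lemma bary_dilation: "bary K v (z + r *\<^sub>R (x - z)) = (1 - r) * bary K v z + r * bary K v x"
  by (subst (1 2 3) bary_affine) (simp add: inner_simps algebra_simps sum.distrib sum_subtractf sum_distrib_left)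

lemma continuous_on_bary: "continuous_on S (bary K v)"
proof -
  have "continuous_on S (\<lambda>x. bary K v 0 + (\<Sum>b\<in>Basis. (x \<bullet> b) * (bary K v b - bary K v 0)))"
    by (intro continuous_intros)
  then show ?thesis by (simp add: bary_affine[symmetric])
qed

lemma polyfn_bary: "polyfn ((\<lambda>b x. x \<bullet> b) ` Basis) 1 (bary K v)"
proof -
  have "polyfn ((\<lambda>b x. x \<bullet> b) ` Basis) 1
      (\<lambda>x. bary K v 0 + (\<Sum>b\<in>Basis. (bary K v b - bary K v 0) * (x \<bullet> b)))"
    by (intro polyfn.add polyfn.const polyfn_sum polyfn_cmult polyfn_gen) auto
  also have "(\<lambda>x. bary K v 0 + (\<Sum>b\<in>Basis. (bary K v b - bary K v 0) * (x \<bullet> b))) = bary K v"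
    by (rule ext, subst (3) bary_affine) (simp add: mult.commute)
  finally show ?thesis .
qed

lemma mem_face_iff:
  assumes "C \<subseteq> verts K"
  shows "x \<in> convex hull C \<longleftrightarrow> (\<forall>v\<in>C. 0 \<le> bary K v x) \<and> (\<forall>v\<in>verts K - C. bary K v x = 0)"
proof
  assume "x \<in> convex hull C"
  then obtain u where u: "\<forall>v\<in>C. 0 \<le> u v" "(\<Sum>v\<in>C. u v) = 1" "(\<Sum>v\<in>C. u v *\<^sub>R v) = x"
    using convex_hull_finite[OF finite_subset[OF assms finite_verts]] by auto
  define c where "c v = (if v \<in> C then u v else 0)" for v
  have "(\<Sum>v\<in>verts K. c v) = (\<Sum>v\<in>C. c v)" "(\<Sum>v\<in>verts K. c v *\<^sub>R v) = (\<Sum>v\<in>C. c v *\<^sub>R v)"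
    by (intro sum.mono_neutral_right finite_verts assms; simp add: c_def)+
  moreover have "(\<Sum>v\<in>C. c v) = 1" "(\<Sum>v\<in>C. c v *\<^sub>R v) = x"
    using u by (simp_all add: c_def cong: sum.cong)
  ultimately have "bary K v x = c v" if "v \<in> verts K" for v
    using bary_unique[OF that, of c x] by simp
  then show "(\<forall>v\<in>C. 0 \<le> bary K v x) \<and> (\<forall>v\<in>verts K - C. bary K v x = 0)"
    using u assms by (auto simp: c_def subset_eq)
next
  assume r: "(\<forall>v\<in>C. 0 \<le> bary K v x) \<and> (\<forall>v\<in>verts K - C. bary K v x = 0)"
  have "(\<Sum>v\<in>C. bary K v x) = (\<Sum>v\<in>verts K. bary K v x)"
    "(\<Sum>v\<in>C. bary K v x *\<^sub>R v) = (\<Sum>v\<in>verts K. bary K v x *\<^sub>R v)"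
    by (intro sum.mono_neutral_left finite_verts assms; use r in simp)+
  then have "\<exists>u. (\<forall>v\<in>C. 0 \<le> u v) \<and> (\<Sum>v\<in>C. u v) = 1 \<and> (\<Sum>v\<in>C. u v *\<^sub>R v) = x"
    using r by (intro exI[of _ "\<lambda>v. bary K v x"]) (simp add: sum_bary sum_bary_scaleR)
  then show "x \<in> convex hull C"
    unfolding convex_hull_finite[OF finite_subset[OF assms finite_verts]] by (rule CollectI)
qed

lemma face_iff: "\<tau> face_of K \<longleftrightarrow> verts \<tau> \<subseteq> verts K \<and> \<tau> = convex hull (verts \<tau>)"
proof -
  have sub: "verts (convex hull C) = C" if "C \<subseteq> verts K" for C
    using affine_independent_subset[OF independent that] by (rule verts_convex_hull)
  show ?thesis
    using face_of_convex_hull_affine_independent[OF independent, of \<tau>] sub unfolding hull[symmetric]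
    by metis
qed

lemma verts_face: "C \<subseteq> verts K \<Longrightarrow> verts (convex hull C) = C"
  using affine_independent_subset[OF independent] verts_convex_hull by blast

lemma aff_dim_face: "C \<subseteq> verts K \<Longrightarrow> aff_dim (convex hull C) = int (card C) - 1"
  using affine_independent_subset[OF independent] by (simp add: aff_dim_convex_hull aff_dim_affine_independent)

text \<open>Coordinates of a point of a face do not see the rest of the simplex; hence two elements
  agree on their intersection.\<close>

lemma bary_face:
  assumes "\<tau> face_of K" "x \<in> \<tau>"
  shows "bary \<tau> v x = bary K v x"
proof -
  have \<tau>: "verts \<tau> \<subseteq> verts K" "\<tau> = convex hull (verts \<tau>)" using assms face_iff by auto
  have zero: "bary K v x = 0" if "v \<notin> verts \<tau>" for v
    using mem_face_iff[OF \<tau>(1), of x] \<tau>(2) assms(2) that bary_outside by (cases "v \<in> verts K") auto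
  have "(\<Sum>v\<in>verts \<tau>. bary K v x) = (\<Sum>v\<in>verts K. bary K v x)"
    "(\<Sum>v\<in>verts \<tau>. bary K v x *\<^sub>R v) = (\<Sum>v\<in>verts K. bary K v x *\<^sub>R v)"
    by (intro sum.mono_neutral_left finite_verts \<tau>(1); simp add: zero)+
  then show ?thesis
    using zero affine_independent_subset[OF independent \<tau>(1)]
    by (intro bary_eqI[where c = "\<lambda>v. bary K v x"]) (simp_all add: sum_bary sum_bary_scaleR)
qed

end

section \<open>Polynomials in Cartesian variables\<close>

lemma poly_space_cmult: "p \<in> poly_space B m \<Longrightarrow> (\<lambda>x. a * p x) \<in> poly_space B m"
  unfolding poly_space_def by (auto simp: sum_distrib_left mult.assoc[symmetric])

lemma poly_space_add: "p \<in> poly_space B m \<Longrightarrow> q \<in> poly_space B m \<Longrightarrow> (\<lambda>x. p x + q x) \<in> poly_space B m"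
proof -
  assume "p \<in> poly_space B m" "q \<in> poly_space B m"
  then obtain c d where
    "p = (\<lambda>x. \<Sum>\<beta> | \<beta> \<in> B \<rightarrow>\<^sub>E UNIV \<and> (\<Sum>b\<in>B. \<beta> b) \<le> m. c \<beta> * (\<Prod>b\<in>B. (x \<bullet> b) ^ \<beta> b))"
    "q = (\<lambda>x. \<Sum>\<beta> | \<beta> \<in> B \<rightarrow>\<^sub>E UNIV \<and> (\<Sum>b\<in>B. \<beta> b) \<le> m. d \<beta> * (\<Prod>b\<in>B. (x \<bullet> b) ^ \<beta> b))"
    unfolding poly_space_def by auto
  then show ?thesis
    unfolding poly_space_def
    by (auto simp: sum.distrib[symmetric] distrib_right[symmetric] intro!: exI[of _ "\<lambda>\<beta>. c \<beta> + d \<beta>"])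
qed

lemma finite_exponents:
  assumes "finite B"
  shows "finite {\<beta>. \<beta> \<in> B \<rightarrow>\<^sub>E (UNIV :: nat set) \<and> (\<Sum>b\<in>B. \<beta> b) \<le> m}"
proof (rule finite_subset)
  show "finite (B \<rightarrow>\<^sub>E {..m})" using assms by (intro finite_PiE) auto
  show "{\<beta>. \<beta> \<in> B \<rightarrow>\<^sub>E UNIV \<and> (\<Sum>b\<in>B. \<beta> b) \<le> m} \<subseteq> B \<rightarrow>\<^sub>E {..m}"
  proof (intro subsetI PiE_I)
    fix \<beta> b assume \<beta>: "\<beta> \<in> {\<beta>. \<beta> \<in> B \<rightarrow>\<^sub>E UNIV \<and> (\<Sum>b\<in>B. \<beta> b) \<le> m}" and "b \<in> B"
    then have "\<beta> b \<le> (\<Sum>b\<in>B. \<beta> b)" using assms by (intro member_le_sum) auto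
    then show "\<beta> b \<in> {..m}" using \<beta> by simp
  qed (auto simp: PiE_iff extensional_def)
qed

lemma poly_space_monomial:
  assumes "finite B" "(\<Sum>b\<in>B. \<beta> b) \<le> m"
  shows "(\<lambda>x. \<Prod>b\<in>B. (x \<bullet> b) ^ \<beta> b) \<in> poly_space B m"
proof -
  let ?I = "{\<beta>. \<beta> \<in> B \<rightarrow>\<^sub>E (UNIV :: nat set) \<and> (\<Sum>b\<in>B. \<beta> b) \<le> m}"
  have "restrict \<beta> B \<in> ?I" using assms by auto
  then have "(\<Sum>\<gamma>\<in>?I. (if \<gamma> = restrict \<beta> B then 1 else 0) * (\<Prod>b\<in>B. (x \<bullet> b) ^ \<gamma> b)) =
      (\<Prod>b\<in>B. (x \<bullet> b) ^ \<beta> b)" for x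
    using finite_exponents[OF assms(1), of m]
    by (simp add: if_distrib[of "\<lambda>c. c * _"] cong: if_cong)
  then show ?thesis unfolding poly_space_def by (force intro!: exI[of _ "\<lambda>\<gamma>. if \<gamma> = restrict \<beta> B then 1 else 0"])
qed

lemma poly_space_sum:
  assumes "finite B" "\<And>i. i \<in> I \<Longrightarrow> p i \<in> poly_space B m"
  shows "(\<lambda>x. \<Sum>i\<in>I. p i x) \<in> poly_space B m"
proof -
  have zero: "(\<lambda>x. 0) \<in> poly_space B m"
    using poly_space_cmult[OF poly_space_monomial[OF assms(1), of "\<lambda>_. 0" m], of 0] by simp
  show ?thesis
    using assms(2) by (induction I rule: infinite_finite_induct) (auto intro: zero poly_space_add)
qed

lemma polyfn_imp_poly_space:
  assumes "polyfn ((\<lambda>b x. x \<bullet> b) ` B) m f" "finite B"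
  shows "f \<in> poly_space B m"
  using assms(1)
proof (induction rule: polyfn.induct)
  case (const m c)
  show ?case
    using poly_space_cmult[OF poly_space_monomial[OF assms(2), of "\<lambda>_. 0" m], of c] by simp
next
  case (add m f g)
  then show ?case by (intro poly_space_add)
next
  case (gen_mult m f g)
  then obtain a where a: "a \<in> B" "g = (\<lambda>x. x \<bullet> a)" by auto
  let ?I = "{\<beta>. \<beta> \<in> B \<rightarrow>\<^sub>E (UNIV :: nat set) \<and> (\<Sum>b\<in>B. \<beta> b) \<le> m}"
  obtain c where c: "f = (\<lambda>x. \<Sum>\<beta>\<in>?I. c \<beta> * (\<Prod>b\<in>B. (x \<bullet> b) ^ \<beta> b))"
    using gen_mult.IH unfolding poly_space_def by auto
  have "(\<lambda>x. g x * f x) = (\<lambda>x. \<Sum>\<beta>\<in>?I. c \<beta> * (\<Prod>b\<in>B. (x \<bullet> b) ^ (\<beta>(a := Suc (\<beta> a))) b))"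
    using a assms(2) by (simp add: c sum_distrib_left prod.remove[of B a] mult_ac)
  moreover have "(\<Sum>b\<in>B. (\<beta>(a := Suc (\<beta> a))) b) \<le> Suc m" if "\<beta> \<in> ?I" for \<beta>
    using that a assms(2) by (simp add: sum.remove[of B a])
  ultimately show ?case
    using assms(2) by (auto intro!: poly_space_sum poly_space_cmult poly_space_monomial)
qed

text \<open>Each monomial of degree at most 1 is 1 or a single variable, and both respect affine
  combinations. So vertex values determine an affine function on an element.\<close>

lemma poly_space_affine_combination:
  fixes p :: "'a::euclidean_space \<Rightarrow> real"
  assumes "p \<in> poly_space B 1" "finite B" "(\<Sum>v\<in>V. c v) = 1"
  shows "p (\<Sum>v\<in>V. c v *\<^sub>R v) = (\<Sum>v\<in>V. c v * p v)"
proof -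
  let ?I = "{\<beta>. \<beta> \<in> B \<rightarrow>\<^sub>E (UNIV :: nat set) \<and> (\<Sum>b\<in>B. \<beta> b) \<le> 1}"
  obtain a where a: "p = (\<lambda>x. \<Sum>\<beta>\<in>?I. a \<beta> * (\<Prod>b\<in>B. (x \<bullet> b) ^ \<beta> b))"
    using assms(1) unfolding poly_space_def by auto
  have mono: "(\<Prod>b\<in>B. ((\<Sum>v\<in>V. c v *\<^sub>R v) \<bullet> b) ^ \<beta> b) = (\<Sum>v\<in>V. c v * (\<Prod>b\<in>B. (v \<bullet> b) ^ \<beta> b))"
    if "(\<Sum>b\<in>B. \<beta> b) \<le> 1" for \<beta>
  proof (cases "\<exists>a\<in>B. \<beta> a \<noteq> 0")
    case True
    then obtain a where a: "a \<in> B" "\<beta> a \<noteq> 0" by blast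
    have split: "(\<Sum>b\<in>B. \<beta> b) = \<beta> a + (\<Sum>b\<in>B - {a}. \<beta> b)" using a assms(2) by (simp add: sum.remove)
    then have "\<beta> a = 1" "(\<Sum>b\<in>B - {a}. \<beta> b) = 0" using that a by auto
    then have "\<beta> a = 1" "\<And>b. b \<in> B - {a} \<Longrightarrow> \<beta> b = 0" using assms(2) by auto
    then have mono: "(\<Prod>b\<in>B. (x \<bullet> b) ^ \<beta> b) = x \<bullet> a" for x :: 'a
      using a assms(2) by (simp add: prod.remove[of B a])
    show ?thesis unfolding mono by (simp add: inner_sum_left)
  next
    case False
    then show ?thesis using assms(3) by simp
  qed
  have "p (\<Sum>v\<in>V. c v *\<^sub>R v) = (\<Sum>\<beta>\<in>?I. \<Sum>v\<in>V. c v * (a \<beta> * (\<Prod>b\<in>B. (v \<bullet> b) ^ \<beta> b)))"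
    unfolding a
  proof (rule sum.cong[OF refl])
    fix \<beta> assume "\<beta> \<in> ?I"
    then have "(\<Sum>b\<in>B. \<beta> b) \<le> 1" by simp
    then show "a \<beta> * (\<Prod>b\<in>B. ((\<Sum>v\<in>V. c v *\<^sub>R v) \<bullet> b) ^ \<beta> b) =
        (\<Sum>v\<in>V. c v * (a \<beta> * (\<Prod>b\<in>B. (v \<bullet> b) ^ \<beta> b)))"
      by (simp only: mono sum_distrib_left mult.left_commute)
  qed
  also have "\<dots> = (\<Sum>v\<in>V. c v * p v)"
    unfolding a sum_distrib_left by (rule sum.swap)
  finally show ?thesis .
qed

section \<open>Functions on a mesh\<close>

locale mesh =
  fixes \<Omega> :: "'a::euclidean_space set" and \<T> :: "'a set set"
  assumes conforming: "conforming_mesh \<Omega> \<T>"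
begin

lemma full_simplex: "K \<in> \<T> \<Longrightarrow> full_simplex K"
  using conforming by (simp add: conforming_mesh_def full_simplex_def)

lemma compact_element: "K \<in> \<T> \<Longrightarrow> compact K"
  using full_simplex.simplex[OF full_simplex] simplex_imp_polytope
    polytope_imp_compact by blast

lemma bary_eq_on_intersection:
  assumes "K \<in> \<T>" "K' \<in> \<T>" "x \<in> K" "x \<in> K'"
  shows "bary K v x = bary K' v x"
proof -
  have face: "(K \<inter> K') face_of K" "(K \<inter> K') face_of K'"
    using conforming assms by (auto simp: conforming_mesh_def)
  show ?thesis
    using full_simplex.bary_face[OF full_simplex[OF assms(1)] face(1)]
      full_simplex.bary_face[OF full_simplex[OF assms(2)] face(2)] assms by auto
qed

text \<open>As \<open>hat\<close> is chosen by \<open>SOME\<close>, a witness is needed first: the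
  coordinates of the elements, glued along common faces. Whatever function is chosen, it is affine
  on each element with the same vertex values.\<close>

lemma hat_eq_bary:
  shows hat_continuous: "continuous_on (\<Union>\<T>) (hat \<T> z)"
    and hat_on_element: "K \<in> \<T> \<Longrightarrow> x \<in> K \<Longrightarrow> hat \<T> z x = bary K z x"
proof -
  define \<phi> where "\<phi> x = bary (SOME K. K \<in> \<T> \<and> x \<in> K) z x" for x
  have \<phi>: "\<phi> x = bary K z x" if "K \<in> \<T>" "x \<in> K" for K x
    unfolding \<phi>_def using that someI[of "\<lambda>K. K \<in> \<T> \<and> x \<in> K" K]
    by (intro bary_eq_on_intersection) auto
  have "continuous_on (\<Union>K\<in>\<T>. K) \<phi>"
  proof (rule continuous_on_closed_Union)
    show "finite \<T>" using conforming by (simp add: conforming_mesh_def)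
    show "closed K" if "K \<in> \<T>" for K using compact_element[OF that] by (rule compact_imp_closed)
    show "continuous_on K \<phi>" if "K \<in> \<T>" for K
      using full_simplex.continuous_on_bary[OF full_simplex[OF that], of K z] \<phi>[OF that]
      by (simp cong: continuous_on_cong)
  qed
  moreover have "bary K z \<in> poly_space Basis 1" if "K \<in> \<T>" for K
    using full_simplex.polyfn_bary[OF full_simplex[OF that]] by (rule polyfn_imp_poly_space) simp
  ultimately have "\<phi> \<in> S_space 1 \<T>" using \<phi> by (auto simp: S_space_def)
  moreover have "\<phi> y = (if y = z then 1 else 0)" if y: "y \<in> mesh_vertices \<T>" for y
  proof -
    obtain K where K: "K \<in> \<T>" "y \<in> verts K" using y by (auto simp: mesh_vertices_def)
    interpret full_simplex K using K by (intro full_simplex)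
    have "y \<in> K" using hull_inc[of y "verts K" convex] hull K by simp
    then show ?thesis
      using \<phi>[OF K(1)] bary_vertex[of z y] K bary_outside[of z y] by (cases "z \<in> verts K") auto
  qed
  ultimately have "\<exists>\<phi>. \<phi> \<in> S_space 1 \<T> \<and> (\<forall>y\<in>mesh_vertices \<T>. \<phi> y = (if y = z then 1 else 0))"
    by blast
  then have hat: "hat \<T> z \<in> S_space 1 \<T> \<and> (\<forall>y\<in>mesh_vertices \<T>. hat \<T> z y = (if y = z then 1 else 0))"
    unfolding hat_def by (rule someI_ex)
  then show "continuous_on (\<Union>\<T>) (hat \<T> z)" by (simp add: S_space_def)
  assume K: "K \<in> \<T>" "x \<in> K"
  interpret full_simplex K using K by (intro full_simplex)
  obtain p where p: "p \<in> poly_space Basis 1" "\<And>x. x \<in> K \<Longrightarrow> hat \<T> z x = p x"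
    using hat K by (auto simp: S_space_def)
  have vertex: "p v = (if v = z then 1 else 0)" if "v \<in> verts K" for v
  proof -
    have "v \<in> K" using hull_inc[of v "verts K" convex] hull that by simp
    then show ?thesis using hat K that p(2)[of v] by (auto simp: mesh_vertices_def)
  qed
  have "hat \<T> z x = p (\<Sum>v\<in>verts K. bary K v x *\<^sub>R v)" using p(2)[OF K(2)] by (simp add: sum_bary_scaleR)
  also have "\<dots> = (\<Sum>v\<in>verts K. bary K v x * p v)"
    by (intro poly_space_affine_combination[OF p(1)] sum_bary) simp
  also have "\<dots> = (\<Sum>v\<in>verts K. if v = z then bary K z x else 0)"
    by (intro sum.cong) (auto simp: vertex)
  also have "\<dots> = bary K z x" using finite_verts bary_outside[of z x] by auto
  finally show "hat \<T> z x = bary K z x" .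
qed

text \<open>A mesh face is a face of some element; conformity transfers this to every element
  containing it, from any of which the trace may be taken.\<close>

lemma face_of_element:
  assumes "\<tau> \<in> mesh_faces \<T> l" "K \<in> \<T>" "\<tau> \<subseteq> K"
  shows "\<tau> face_of K"
proof -
  obtain K' where K': "K' \<in> \<T>" "\<tau> face_of K'" using assms(1) by (auto simp: mesh_faces_def)
  have "(K' \<inter> K) face_of K" using conforming assms(2) K'(1) by (auto simp: conforming_mesh_def)
  moreover have "\<tau> face_of (K' \<inter> K)"
    using face_of_imp_subset[OF K'(2)] assms(3)
    by (intro face_of_subset[OF K'(2)] Int_greatest Int_lower1)
  ultimately show ?thesis by (rule face_of_trans[rotated])
qed

lemma finite_facets: "finite (facets \<T>)"
proof (rule finite_subset)
  show "facets \<T> \<subseteq> (\<Union>K\<in>\<T>. {F. F face_of K})" by (auto simp: facets_def mesh_faces_def)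
  have "finite {F. F face_of K}" if "K \<in> \<T>" for K
    using full_simplex.simplex[OF full_simplex[OF that]] simplex_imp_polytope
      finite_polytope_faces by blast
  then show "finite (\<Union>K\<in>\<T>. {F. F face_of K})"
    using conforming by (auto simp: conforming_mesh_def)
qed

text \<open>Needed because the integral form of a functional is available only on
  \<open>CR_space\<close>. The product of hats has degree \<open>l + 1\<close>, leaving
  \<open>k - (l + 1)\<close> for the Jacobi factors.\<close>

lemma B_conf_in_CR_space:
  assumes num: "vertex_numbering \<T> A" and index: "(\<tau>, \<alpha>) \<in> index_set k \<T>" and "1 \<le> k"
  shows "B_conf \<T> A \<tau> \<alpha> \<in> CR_space k \<T>"
proof -
  obtain l where l: "1 \<le> l" "l \<le> k - 1" "l \<le> DIM('a)" "\<tau> \<in> mesh_faces \<T> l"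
    "(\<Sum>j=1..l. \<alpha> j) \<le> k - (l + 1)"
    using index by (auto simp: index_set_def)
  then have bij: "bij_betw (A \<tau>) {0..l} (verts \<tau>)" using num by (auto simp: vertex_numbering_def)
  have dim: "nat (aff_dim \<tau>) = l" using l by (simp add: mesh_faces_def)
  have card: "card (verts \<tau>) = Suc l" using bij_betw_same_card[OF bij] by simp
  have deg: "(\<Sum>z\<in>verts \<tau>. 1) + (\<Sum>j=1..l. \<alpha> j) \<le> k" using l card \<open>1 \<le> k\<close> by simp
  define f where "f y x = (\<Prod>z\<in>verts \<tau>. y z x) * bary_jacobi l \<alpha> (\<lambda>i. y (A \<tau> i) x)"
    for y :: "'a \<Rightarrow> 'a \<Rightarrow> real" and x
  have poly: "polyfn (range y) k (f y)" for y
  proof (rule polyfn_mono_degree[OF _ deg])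
    show "polyfn (range y) ((\<Sum>z\<in>verts \<tau>. 1) + (\<Sum>j=1..l. \<alpha> j)) (f y)"
      unfolding f_def by (intro polyfn_mult polyfn_prod polyfn_bary_jacobi polyfn_gen rangeI)
  qed
  have B: "B_conf \<T> A \<tau> \<alpha> K x = f (hat \<T>) x" for K x
    by (simp add: B_conf_def W_face_def f_def dim)
  have "f (hat \<T>) \<in> S_space k \<T>"
    unfolding S_space_def
  proof (intro CollectI conjI ballI)
    show "continuous_on (\<Union>\<T>) (f (hat \<T>))"
      by (rule polyfn_continuous_on[OF poly]) (auto intro: hat_continuous)
    fix K assume K: "K \<in> \<T>"
    have "polyfn ((\<lambda>b x. x \<bullet> b) ` Basis) k (f (bary K))"
      by (rule polyfn_subst[OF poly]) (use full_simplex.polyfn_bary[OF full_simplex[OF K]] in auto)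
    then have "f (bary K) \<in> poly_space Basis k" by (rule polyfn_imp_poly_space) simp
    moreover have "\<forall>x\<in>K. f (hat \<T>) x = f (bary K) x"
      using hat_on_element[OF K] by (simp add: f_def)
    ultimately show "\<exists>p\<in>poly_space Basis k. \<forall>x\<in>K. f (hat \<T>) x = p x" by blast
  qed
  then show ?thesis
    unfolding CR_space_def B by (auto intro!: bexI[of _ "f (hat \<T>)"] exI[of _ "\<lambda>_. 0"])
qed

lemma B_CR_facet_in_CR_space:
  assumes "F \<in> facets \<T>"
  shows "B_CR_facet k F \<in> CR_space k \<T>"
proof -
  have "(\<lambda>x. 0) \<in> poly_space (Basis :: 'a set) k"
    by (intro polyfn_imp_poly_space polyfn.const) simp
  then have "(\<lambda>x. 0) \<in> S_space k \<T>" by (auto simp: S_space_def)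
  moreover have "B_CR_facet k F K x = 0 + (\<Sum>F'\<in>facets \<T>. (if F' = F then 1 else 0) * B_CR_facet k F' K x)"
    for K x
    using assms finite_facets by (simp add: if_distrib[of "\<lambda>c. c * _"] cong: if_cong)
  ultimately show ?thesis
    unfolding CR_space_def
    by (intro CollectI bexI[of _ "\<lambda>x. 0"] exI[of _ "\<lambda>F'. if F' = F then 1 else 0"] ballI)
qed

end

text \<open>With \<open>b = d - 2\<close> this is the number e of the introduction.\<close>

lemma jacobi_vertex_value_nonzero:
  assumes "2 \<le> k" "1 \<le> b"
  shows "real (Suc b) + poly (jacobi 0 b k) (- 1) \<noteq> 0"
proof -
  \<comment> \<open>At \<open>k = 2\<close> this reads \<open>b + 1 < (b + 2) * (b + 1) / 2\<close>,
    which is where \<open>b \<ge> 1\<close> enters. A strict inequality rules out cancellation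
    whatever the sign \<open>(- 1) ^ k\<close>.\<close>
  have binom: "Suc b < (k + b choose k)"
    using assms(1)
  proof (induction k rule: dec_induct)
    case base
    have binom: "(b + 2) * (b + 1) = 2 * (2 + b choose 2)"
      by (simp add: choose_two algebra_simps)
    have "2 * Suc b < (b + 2) * (b + 1)" using assms(2) by simp
    then show ?case unfolding binom by simp
  next
    case (step k)
    have "(k + b choose k) \<le> (Suc k + b choose Suc k)" by simp
    then show ?case using step.IH by linarith
  qed
  have "poly (jacobi 0 b k) (- 1) = (- 1) ^ k * real (k + b choose k)"
    by (simp add: poly_jacobi_minus_1 binomial_fact)
  moreover have "\<bar>(- 1) ^ k * real (k + b choose k)\<bar> = real (k + b choose k)"
    by (simp add: abs_mult power_abs)
  ultimately show ?thesis using binom by linarith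
qed

section \<open>The contradiction on a single facet\<close>

context mesh
begin

text \<open>Only faces inside F are tested, so the statement serves the full basis and the one with
  boundary conditions alike.\<close>

lemma facet_functional_vanishes:
  fixes g :: "'a \<Rightarrow> real"
  assumes "3 \<le> DIM('a)" "2 \<le> k" and num: "vertex_numbering \<T> A"
    and F: "F \<in> facets \<T>" and K: "K \<in> \<T>" "F \<subseteq> K"
    and g: "g \<in> poly_on_face (k - 1) F"
    and orth: "\<And>\<tau> \<alpha>. (\<tau>, \<alpha>) \<in> index_set k \<T> \<Longrightarrow> \<tau> \<subseteq> F \<Longrightarrow> \<tau> \<noteq> {} \<Longrightarrow>
      (LINT x:F|flat_measure F. g x * B_conf \<T> A \<tau> \<alpha> K x) = 0"
  shows "(LINT x:F|flat_measure F. g x * B_CR_facet k F K x) = 0"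
proof -
  interpret full_simplex K using K(1) by (rule full_simplex)
  define d where "d = DIM('a)"
  have d: "3 \<le> d" using assms by (simp add: d_def)
  have face: "F face_of K" using F K by (auto intro: face_of_element simp: facets_def)
  define V where "V = verts F"
  have V: "V \<subseteq> verts K" "F = convex hull V" using face by (auto simp: V_def face_iff)
  have finV: "finite V" using V finite_verts finite_subset by blast
  have dimF: "aff_dim F = int (d - 1)" using F by (simp add: facets_def mesh_faces_def d_def)
  then have cardV: "card V = d" using aff_dim_face[OF V(1)] d V(2) by simp
  then have "card (verts K - V) = 1"
    using card_verts card_Diff_subset[OF finV V(1)] by (simp add: d_def)
  then obtain w where w: "verts K - V = {w}" by (auto simp: card_1_singleton_iff)
  have wK: "w \<in> verts K" "w \<notin> V" using w by auto
  have mem: "x \<in> F \<longleftrightarrow> (\<forall>v\<in>V. 0 \<le> bary K v x) \<and> bary K w x = 0" for x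
    using mem_face_iff[OF V(1), of x] w V(2) by simp
  have V_mem: "v \<in> F" if "v \<in> V" for v using that V hull_inc[of v V convex] by simp
  have wF: "w \<notin> F" using mem[of w] bary_vertex[OF wK(1) wK(1)] by auto
  have opp: "opposite_vertex K F = w"
    unfolding opposite_vertex_def using w wF V_mem by (intro the_equality) auto
  have sumV: "(\<Sum>v\<in>V. bary K v x) = 1" if "x \<in> F" for x
  proof -
    have "(\<Sum>v\<in>verts K. bary K v x) = (\<Sum>v\<in>V. bary K v x) + (\<Sum>v\<in>verts K - V. bary K v x)"
      using sum.subset_diff[OF V(1) finite_verts] by (simp add: add.commute)
    then show ?thesis using sum_bary[of x] that mem w by simp
  qed
  have le1: "bary K v x \<le> 1" if "x \<in> F" "v \<in> V" for v x
    using sumV[OF that(1)] member_le_sum[OF that(2), where f = "\<lambda>v. bary K v x"] finV mem[of x] that by auto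
  have compF: "compact F" using V finV by (simp add: finite_imp_compact_convex_hull)
  define p where "p = jacobi 0 (d - 2) k"
  have p: "degree p = k" "poly p 1 = 1"
    by (simp_all add: p_def degree_jacobi poly_jacobi_1 pochhammer_fact[symmetric])
  \<comment> \<open>Continuity is included to guarantee integrability, without which the integral
    would not be additive.\<close>
  define N where "N f \<longleftrightarrow> continuous_on F f \<and> (LINT x:F|flat_measure F. g x * f x) = 0" for f
  have "g \<in> poly_space (tangent_basis F) (k - 1)" using g by (simp add: poly_on_face_def)
  then have g_cont: "continuous_on F g"
    unfolding poly_space_def by (auto intro!: continuous_intros)
  have int: "set_integrable (flat_measure F) F (\<lambda>x. g x * f x)" if "continuous_on F f" for f
    using that g_cont by (intro set_integrable_flat_measure compF continuous_intros)
  interpret N: linear_class F N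
  proof
    fix f h assume f: "N f" and h: "\<And>x. x \<in> F \<Longrightarrow> f x = h x"
    have "(LINT x:F|flat_measure F. g x * f x) = (LINT x:F|flat_measure F. g x * h x)"
      using h compact_imp_closed[OF compF] by (intro set_lebesgue_integral_cong) (auto simp: borel_closed)
    then show "N h" using f h unfolding N_def by (simp cong: continuous_on_cong)
  next
    show "N (\<lambda>x. f x + h x)" if "N f" "N h" for f h
      using that set_integral_add(2)[OF int int, of f h]
      by (auto simp: N_def distrib_left intro: continuous_intros)
    show "N (\<lambda>x. c * f x)" if "N f" for c f
      using that by (auto simp: N_def mult.left_commute[of _ c] intro: continuous_intros)
  qed (simp add: N_def)
  interpret face_functions F N V "bary K" "\<lambda>\<tau>. A (convex hull \<tau>)" k
  proof
    show "finite V" by (rule finV)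
    show "(\<Sum>v\<in>V. bary K v x) = 1" if "x \<in> F" for x using that by (rule sumV)
    fix \<tau> l assume \<tau>: "\<tau> \<subseteq> V" "card \<tau> = Suc l" "1 \<le> l"
    have \<tau>K: "\<tau> \<subseteq> verts K" using \<tau> V by blast
    have face\<tau>: "convex hull \<tau> face_of K" using \<tau>K by (simp add: face_iff verts_face)
    have l: "l \<le> DIM('a)" using card_mono[OF finV \<tau>(1)] \<tau>(2) cardV d_def by simp
    have mf: "convex hull \<tau> \<in> mesh_faces \<T> l"
      using face\<tau> K(1) aff_dim_face[OF \<tau>K] \<tau>(2) by (auto simp: mesh_faces_def)
    have "bij_betw (A (convex hull \<tau>)) {0..l} (verts (convex hull \<tau>))"
      using num mf l unfolding vertex_numbering_def by blast
    then show "bij_betw (A (convex hull \<tau>)) {0..l} \<tau>" by (simp add: verts_face[OF \<tau>K])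
    fix \<alpha> :: "nat \<Rightarrow> nat" assume k: "Suc l \<le> k" "(\<Sum>j=1..l. \<alpha> j) \<le> k - Suc l"
    define \<beta> where "\<beta> = restrict \<alpha> {1..l}"
    define f where "f x = (\<Prod>v\<in>\<tau>. bary K v x) * bary_jacobi l \<alpha> (\<lambda>i. bary K (A (convex hull \<tau>) i) x)" for x
    have index: "(convex hull \<tau>, \<beta>) \<in> index_set k \<T>"
      using mf \<tau> l k by (auto simp: index_set_def \<beta>_def intro!: exI[of _ l])
    have sub: "convex hull \<tau> \<subseteq> F" unfolding V(2) using \<tau>(1) by (rule hull_mono)
    have "\<tau> \<noteq> {}" using \<tau> by auto
    then have zero: "(LINT x:F|flat_measure F. g x * B_conf \<T> A (convex hull \<tau>) \<beta> K x) = 0"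
      by (intro orth index sub) simp
    have B: "B_conf \<T> A (convex hull \<tau>) \<beta> K x = f x" if "x \<in> F" for x
    proof -
      have "x \<in> K" using that K by blast
      moreover have "bary_jacobi l \<beta> (\<lambda>i. bary K (A (convex hull \<tau>) i) x) =
          bary_jacobi l \<alpha> (\<lambda>i. bary K (A (convex hull \<tau>) i) x)"
        by (intro bary_jacobi_cong) (auto simp: \<beta>_def)
      ultimately show ?thesis
        using hat_on_element[OF K(1)] aff_dim_face[OF \<tau>K] \<tau>(2) verts_face[OF \<tau>K]
        by (simp add: B_conf_def W_face_def f_def)
    qed
    have "polyfn (range (bary K)) ((\<Sum>v\<in>\<tau>. 1) + (\<Sum>j=1..l. \<alpha> j)) f"
      unfolding f_def by (intro polyfn_mult polyfn_prod polyfn_bary_jacobi polyfn_gen rangeI)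
    then have "continuous_on F f"
      by (rule polyfn_continuous_on) (auto intro: continuous_on_bary)
    moreover have "(LINT x:F|flat_measure F. g x * f x) = 0"
      using B compact_imp_closed[OF compF] unfolding zero[symmetric]
      by (intro set_lebesgue_integral_cong) (auto simp: borel_closed)
    ultimately show "N (\<lambda>x. (\<Prod>v\<in>\<tau>. bary K v x) *
        bary_jacobi l \<alpha> (\<lambda>i. bary K (A (convex hull \<tau>) i) x))"
      unfolding N_def f_def by simp
  qed
  define q where "q = p \<circ>\<^sub>p [:1, - 2:]"
  have q: "poly q s = poly p (1 - 2 * s)" for s by (simp add: q_def poly_pcompose mult.commute)
  have q_N: "N (\<lambda>x. poly q (bary K z x))" if z: "z \<in> V" for z
    unfolding N_def
  proof
    show "continuous_on F (\<lambda>x. poly q (bary K z x))" by (intro continuous_intros continuous_on_bary)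
    have zw: "z \<noteq> w" "z \<in> verts K" "w \<in> verts K" using z V w by auto
    \<comment> \<open>A dilation about z multiplies \<open>1 - bary K z\<close> and the coordinates
      of all other vertices by r.\<close>
    have dil: "bary K v (z + r *\<^sub>R (x - z)) = (if v = z then 1 - r + r * bary K z x else r * bary K v x)"
      if "v \<in> verts K" for v r x
      using bary_dilation[of v z r x] bary_vertex[OF that zw(2)] by simp
    \<comment> \<open>The layer parameter \<open>1 - bary K z\<close> is 0 at z and 1 on the face of
      F opposite to z.\<close>
    have "(LINT x:F|flat_measure F. g x * poly p (2 * (1 - bary K z x) - 1)) = 0"
    proof (rule facet_orthogonality[OF compF V_mem[OF z] _ _ _ _ g])
      show "card (tangent_basis F) = Suc (d - 2)"
        using card_tangent_basis[OF V_mem[OF z]] dimF d by simp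
      show "continuous_on UNIV (\<lambda>x. 1 - bary K z x)" by (intro continuous_intros continuous_on_bary)
      show "1 - bary K z x \<in> {0..1}" if "x \<in> F" for x using le1[OF that z] mem[of x] that z by auto
      show "z + r *\<^sub>R (x - z) \<in> F \<and> 1 - bary K z (z + r *\<^sub>R (x - z)) \<le> r \<longleftrightarrow> x \<in> F"
        if r: "0 < r" "r \<le> 1" for x r
      proof -
        have eq: "(\<forall>v\<in>V. 0 \<le> c v) \<longleftrightarrow> 0 \<le> c z \<and> (\<forall>v\<in>V - {z}. 0 \<le> c v)" for c :: "'a \<Rightarrow> real"
          using z by auto
        have "(\<forall>v\<in>V - {z}. 0 \<le> bary K v (z + r *\<^sub>R (x - z))) \<longleftrightarrow> (\<forall>v\<in>V - {z}. 0 \<le> bary K v x)"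
          using r V by (intro ball_cong refl) (auto simp: dil zero_le_mult_iff)
        \<comment> \<open>At the dilated point the layer condition reads
          \<open>r * (1 - bary K z x) \<le> r\<close>, that is,
          \<open>bary K z x \<ge> 0\<close>.\<close>
        moreover have "0 \<le> bary K z (z + r *\<^sub>R (x - z)) \<and> 1 - bary K z (z + r *\<^sub>R (x - z)) \<le> r
            \<longleftrightarrow> 0 \<le> bary K z x"
          using r zw by (auto simp: dil zero_le_mult_iff)
        moreover have "bary K w (z + r *\<^sub>R (x - z)) = 0 \<longleftrightarrow> bary K w x = 0"
          using r zw by (auto simp: dil)
        ultimately show ?thesis unfolding mem eq by blast
      qed
      show "integral {-1..1} (\<lambda>x. poly p x * poly q x * ((1 - x) ^ 0 * (1 + x) ^ (d - 2))) = 0"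
        if "degree q \<le> k - 1" for q
        unfolding p_def using that \<open>2 \<le> k\<close> by (intro jacobi_orthogonal) simp
    qed
    then show "(LINT x:F|flat_measure F. g x * poly q (bary K z x)) = 0" by (simp add: q)
  qed
  then have sum_q: "N (\<lambda>x. \<Sum>z\<in>V. poly q (bary K z x))" by (rule N.sum)
  have "degree q \<le> k" by (simp add: q_def degree_pcompose p)
  from N.diff[OF sum_q sum_poly_coordinates[OF this \<open>2 \<le> k\<close>]]
  have const: "N (\<lambda>x. (real (card V) - 1) * poly q 0 + poly q 1)" by simp
  define e where "e = (real (card V) - 1) * poly q 0 + poly q 1"
  \<comment> \<open>Here \<open>q 0 = p 1 = 1\<close> and \<open>q 1 = p (- 1)\<close>.\<close>
  have "e = real (Suc (d - 2)) + poly (jacobi 0 (d - 2) k) (- 1)"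
    using d by (simp add: e_def cardV q p p_def[symmetric] of_nat_diff)
  then have "e \<noteq> 0" using jacobi_vertex_value_nonzero[of k "d - 2"] assms(2) d by simp
  have "N (\<lambda>x. 1)"
    using N.cmult[OF const, of "1 / e"] \<open>e \<noteq> 0\<close> by (simp add: e_def[symmetric])
  from N.diff[OF this N.cmult[OF sum_q, of "1 / real d"]]
  have "N (\<lambda>x. B_CR_facet k F K x)"
  proof (rule N.cong)
    fix x assume x: "x \<in> F"
    \<comment> \<open>On F the coordinate of the opposite vertex w is 0, so w contributes
      \<open>p 1 = 1\<close>, cancelling the \<open>- 1\<close> in \<open>B_CR_elem\<close>.\<close>
    have "(\<Sum>z\<in>verts K. poly p (1 - 2 * bary K z x)) =
        (\<Sum>z\<in>V. poly p (1 - 2 * bary K z x)) + (\<Sum>z\<in>verts K - V. poly p (1 - 2 * bary K z x))"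
      using sum.subset_diff[OF V(1) finite_verts] by (simp add: add.commute)
    also have "\<dots> = (\<Sum>z\<in>V. poly q (bary K z x)) + 1"
      using x mem w by (simp add: q p)
    finally show "1 - 1 / real d * (\<Sum>z\<in>V. poly q (bary K z x)) = B_CR_facet k F K x"
      using K x mem[of x] by (simp add: B_CR_facet_def B_CR_elem_def opp p_def[symmetric] d_def[symmetric] p)
  qed
  then show ?thesis by (simp add: N_def)
qed

lemma no_dual_facet_functional:
  assumes "3 \<le> DIM('a)" "2 \<le> k" "vertex_numbering \<T> A" "F \<in> facets \<T>"
    and J: "facet_functional k \<T> F J" "J (B_CR_facet k F) = 1"
    and orth: "\<And>\<tau> \<alpha>. (\<tau>, \<alpha>) \<in> index_set k \<T> \<Longrightarrow> \<tau> \<subseteq> F \<Longrightarrow> \<tau> \<noteq> {} \<Longrightarrow> J (B_conf \<T> A \<tau> \<alpha>) = 0"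
  shows False
proof -
  obtain g K where g: "g \<in> poly_on_face (k - 1) F" and K: "K \<in> \<T>" "F \<subseteq> K"
    and rep: "\<And>u. u \<in> CR_space k \<T> \<Longrightarrow> J u = (LINT x:F|flat_measure F. g x * u K x)"
    using J(1) unfolding facet_functional_def by blast
  have "(LINT x:F|flat_measure F. g x * B_CR_facet k F K x) = 0"
  proof (rule facet_functional_vanishes[OF assms(1-4) K g])
    show "(LINT x:F|flat_measure F. g x * B_conf \<T> A \<tau> \<alpha> K x) = 0"
      if "(\<tau>, \<alpha>) \<in> index_set k \<T>" "\<tau> \<subseteq> F" "\<tau> \<noteq> {}" for \<tau> \<alpha>
      using rep[OF B_conf_in_CR_space[OF assms(3) that(1)]] orth[OF that] assms(2) by simp
  qed
  then show False using rep[OF B_CR_facet_in_CR_space[OF assms(4)]] J(2) by simp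
qed

text \<open>Nonemptiness is recorded because an empty set would lie in the boundary
  vacuously.\<close>

lemma exists_facet:
  assumes "K \<in> \<T>"
  shows "\<exists>F\<in>facets \<T>. F \<subseteq> K \<and> F \<noteq> {}"
proof -
  interpret full_simplex K using assms by (rule full_simplex)
  obtain w where w: "w \<in> verts K" using card_verts by fastforce
  let ?C = "verts K - {w}"
  have card: "card ?C = DIM('a)" using w card_verts finite_verts by simp
  have "convex hull ?C face_of K" by (simp add: face_iff verts_face)
  moreover have "aff_dim (convex hull ?C) = int (DIM('a) - 1)"
    using aff_dim_face[of ?C] card by (simp add: of_nat_diff Suc_leI)
  ultimately have "convex hull ?C \<in> facets \<T>" using assms by (auto simp: facets_def mesh_faces_def)
  moreover have "?C \<noteq> {}" using card DIM_positive[where 'a = 'a] by (metis card.empty less_irrefl)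
  then have "convex hull ?C \<noteq> {}" by simp
  moreover have "convex hull ?C \<subseteq> K"
    using face_of_imp_subset[OF \<open>convex hull ?C face_of K\<close>] .
  ultimately show ?thesis by blast
qed

end

theorem theorem34:
  fixes \<Omega> :: "'a::euclidean_space set"
    and \<T> :: "'a set set"
    and A :: "'a set \<Rightarrow> nat \<Rightarrow> 'a"
    and mark :: "'a set \<Rightarrow> 'a set"
    and k :: nat
  assumes "DIM('a) \<ge> 3" and "k \<ge> 3" and "odd k"
    and "lipschitz_polytope \<Omega>"
    and "conforming_mesh \<Omega> \<T>"
    and "vertex_numbering \<T> A"
    and "is_marking \<T> mark"
  shows "\<not> (\<exists>J JCR. admissible_functionals k \<T> mark J JCR \<and>
           bidual (index_set k \<T> <+> facets \<T>) (case_sum J JCR) (basis_fun k \<T> A)) \<and>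
         ((\<exists>K\<in>\<T>. K \<inter> frontier \<Omega> = {}) \<longrightarrow>
         \<not> (\<exists>J JCR. admissible_functionals k \<T> mark J JCR \<and>
           bidual (interior_index_set k \<Omega> \<T> <+> interior_facets \<Omega> \<T>)
             (case_sum J JCR) (basis_fun k \<T> A)))"
proof -
  interpret mesh \<Omega> \<T> using assms(5) by unfold_locales
  \<comment> \<open>The index families stay abstract: it is enough that they contain F and all
    conforming indices of faces of F.\<close>
  have main: False
    if adm: "admissible_functionals k \<T> mark J JCR"
      and bi: "bidual (I <+> \<F>) (case_sum J JCR) (basis_fun k \<T> A)"
      and F: "F \<in> facets \<T>" "F \<in> \<F>"
      and I: "\<And>\<tau> \<alpha>. (\<tau>, \<alpha>) \<in> index_set k \<T> \<Longrightarrow> \<tau> \<subseteq> F \<Longrightarrow> \<tau> \<noteq> {} \<Longrightarrow> (\<tau>, \<alpha>) \<in> I"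
    for J JCR I \<F> F
  proof (rule no_dual_facet_functional[OF assms(1) _ assms(6) F(1)])
    have dual: "case_sum J JCR i (basis_fun k \<T> A j) = (if i = j then 1 else 0)"
      if "i \<in> I <+> \<F>" "j \<in> I <+> \<F>" for i j
      using bi that unfolding bidual_def by blast
    show "2 \<le> k" using assms(2) by simp
    show "facet_functional k \<T> F (JCR F)" using adm F unfolding admissible_functionals_def by blast
    show "JCR F (B_CR_facet k F) = 1"
      using dual[of "Inr F" "Inr F"] F by (simp add: basis_fun_def InrI)
    show "JCR F (B_conf \<T> A \<tau> \<alpha>) = 0" if "(\<tau>, \<alpha>) \<in> index_set k \<T>" "\<tau> \<subseteq> F" "\<tau> \<noteq> {}" for \<tau> \<alpha>
      using dual[of "Inr F" "Inl (\<tau>, \<alpha>)"] F I[OF that] by (simp add: basis_fun_def InrI InlI)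
  qed
  have "\<Omega> \<noteq> {}" using assms(4) by (simp add: lipschitz_polytope_def)
  then have "\<Union>\<T> \<noteq> {}" using assms(5) closure_subset[of \<Omega>] by (auto simp: conforming_mesh_def)
  then have "\<T> \<noteq> {}" by auto
  then obtain K F where "K \<in> \<T>" and F: "F \<in> facets \<T>" using exists_facet by blast
  have "\<not> (\<exists>J JCR. admissible_functionals k \<T> mark J JCR \<and>
      bidual (index_set k \<T> <+> facets \<T>) (case_sum J JCR) (basis_fun k \<T> A))"
    using main[OF _ _ F F] by blast
  moreover have "\<not> (\<exists>J JCR. admissible_functionals k \<T> mark J JCR \<and>
      bidual (interior_index_set k \<Omega> \<T> <+> interior_facets \<Omega> \<T>)
        (case_sum J JCR) (basis_fun k \<T> A))"
    if K: "K \<in> \<T>" "K \<inter> frontier \<Omega> = {}" for K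
  proof -
    obtain F where F: "F \<in> facets \<T>" "F \<subseteq> K" "F \<noteq> {}" using exists_facet[OF K(1)] by blast
    \<comment> \<open>Since K misses the boundary, so does every nonempty face of F; no conforming
      function needed on F is lost.\<close>
    have "F \<in> interior_facets \<Omega> \<T>" using F K by (auto simp: interior_facets_def)
    moreover have "(\<tau>, \<alpha>) \<in> interior_index_set k \<Omega> \<T>"
      if "(\<tau>, \<alpha>) \<in> index_set k \<T>" "\<tau> \<subseteq> F" "\<tau> \<noteq> {}" for \<tau> \<alpha>
      using that F(2) K(2) by (auto simp: interior_index_set_def)
    ultimately show ?thesis using main[OF _ _ F(1)] by blast
  qed
  ultimately show ?thesis by blast
qed

end
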